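(* Let $\Gamma$ be a non-elementary, torsion-free, hyperbolic group and let $\Gamma=\Gamma_0\twoheadrightarrow\Gamma_1\twoheadrightarrow\Gamma_2\twoheadrightarrow\cdots$ be a sequence of epimorphisms between non-elementary, torsion-free, hyperbolic groups, with direct limit $\Gamma_\infty$ and projections $\pi_k\colon\Gamma\to\Gamma_k$ ($k\in\mathbb N\cup\{\infty\}$), such that: (i) $\Gamma_\infty$ is a lacunary hyperbolic, simple, torsion-free Tarski monster; (ii) every non-trivial conjugacy-invariant norm on $\Gamma_\infty$ is stably bounded; (iii) for every finite tuple $\vec\gamma$ of elements of $\Gamma$, $\mathrm{Th}_{\forall\exists}(\Gamma_\infty,\pi_\infty(\vec\gamma))=\lim_{k\to\infty}\mathrm{Th}_{\forall\exists}(\Gamma_k,\pi_k(\vec\gamma))$; (iv) $\Gamma_\infty$ $\exists\forall\exists$-elementarily embeds in $\Gamma_\infty*\mathbb Z$. Then $\Gamma_\infty$ is mixed identity free, but does not admit a $2$-transitive action.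
   Context: A mixed identity on a group $\Lambda$ is a word $w\in\Lambda*F_n$ ($F_n$ free of rank $n\ge1$) such that $w(\vec\gamma)=1$ for all $\vec\gamma\in\Lambda^n$ (substituting $\vec\gamma$ for the basis of $F_n$). $\Lambda$ is mixed identity free (MIF) if the only mixed identities are the trivial elements of the groups $\Lambda*F_n$. A $2$-transitive action is an action on a set with at least two elements that is transitive on ordered pairs of distinct points. A torsion-free Tarski monster is a torsion-free, finitely generated, non-abelian group all of whose proper, non-trivial subgroups are infinite cyclic. A finitely generated group is lacunary hyperbolic if one of its asymptotic cones is an $\mathbb R$-tree. A norm on a group $\Lambda$ is a map $\ell\colon\Lambda\to[0,\infty]$ with $\ell(\gamma)=0$ iff $\gamma=1$, $\ell(\gamma^{-1})=\ell(\gamma)$ and $\ell(\gamma_1\gamma_2)\le\ell(\gamma_1)+\ell(\gamma_2)$. It is trivial if it only takes the values $0,\infty$, conjugacy-invariant if $\ell(\gamma\gamma'\gamma^{-1})=\ell(\gamma')$, and stably bounded if $\liminf_{n\to\infty}\ell(\gamma^n)/n=0$ for every $\gamma$. Formulas are first-order formulas in the language of groups. $\mathrm{Th}_{\forall\exists}(\Lambda,\vec\gamma)$ is the set of formulas $\Sigma(\vec z)$ of the form $\forall\vec x\,\exists\vec y\ \phi(\vec x,\vec y,\vec z)$ with $\phi$ quantifier-free and $\vec z$ of the same arity as $\vec\gamma$ such that $\Sigma(\vec\gamma)$ holds in $\Lambda$; $\mathrm{Th}_{\exists\forall\exists}(\Lambda,\vec\gamma)$ is defined similarly for formulas $\exists\vec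 x\,\forall\vec y\,\exists\vec t\ \phi$. For sets $A_k$, $\lim_k A_k$ is the common value of $\bigcup_k\bigcap_{j\ge k}A_j$ and $\bigcap_k\bigcup_{j\ge k}A_j$ when these coincide. $\Lambda$ $\exists\forall\exists$-elementarily embeds in $\Lambda*\mathbb Z$ if $\mathrm{Th}_{\exists\forall\exists}(\Lambda,\vec\gamma)\subset\mathrm{Th}_{\exists\forall\exists}(\Lambda*\mathbb Z,\vec\gamma)$ for every finite tuple $\vec\gamma$ of elements of $\Lambda$. *)

theory Defs
  imports "HOL-Algebra.Group_Action" "HOL-Algebra.Elementary_Groups" "HOL-Analysis.Analysis"
begin

section \<open>Monoids presented by generators and relations\<close>

text \<open>The monoid generated by the letters in \<open>L\<close> subject to the relations \<open>l = r\<close>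
  for \<open>(l, r) \<in> R\<close>. Its elements are classes of words.\<close>

inductive word_cong :: "'l set \<Rightarrow> ('l list \<times> 'l list) set \<Rightarrow> 'l list \<Rightarrow> 'l list \<Rightarrow> bool"
  for L R where
  base: "\<lbrakk>(l, r) \<in> R; u \<in> lists L; v \<in> lists L\<rbrakk> \<Longrightarrow> word_cong L R (u @ l @ v) (u @ r @ v)"
| refl: "w \<in> lists L \<Longrightarrow> word_cong L R w w"
| sym: "word_cong L R v w \<Longrightarrow> word_cong L R w v"
| trans: "\<lbrakk>word_cong L R u v; word_cong L R v w\<rbrakk> \<Longrightarrow> word_cong L R u w"

definition word_class :: "'l set \<Rightarrow> ('l list \<times> 'l list) set \<Rightarrow> 'l list \<Rightarrow> 'l list set" where
  "word_class L R w = {v. word_cong L R w v}"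

definition presented_monoid :: "'l set \<Rightarrow> ('l list \<times> 'l list) set \<Rightarrow> 'l list set monoid" where
  "presented_monoid L R =
     \<lparr>carrier = word_class L R ` lists L,
      monoid.mult = (\<lambda>A B. \<Union>a\<in>A. \<Union>b\<in>B. word_class L R (a @ b)),
      one = word_class L R []\<rparr>"

text \<open>The homomorphism out of a presented monoid that is induced by a map \<open>h\<close> on letters. The
  image \<open>word_eval K h ` W\<close> is a singleton whenever \<open>h\<close> respects the relations.\<close>

definition word_eval :: "('k, 'm) monoid_scheme \<Rightarrow> ('l \<Rightarrow> 'k) \<Rightarrow> 'l list \<Rightarrow> 'k" where
  "word_eval K h w = foldr (\<lambda>l y. h l \<otimes>\<^bsub>K\<^esub> y) w \<one>\<^bsub>K\<^esub>"

definition word_lift :: "('k, 'm) monoid_scheme \<Rightarrow> ('l \<Rightarrow> 'k) \<Rightarrow> 'l list set \<Rightarrow> 'k" where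
  "word_lift K h W = the_elem (word_eval K h ` W)"


section \<open>Free groups and free products\<close>

text \<open>The letter \<open>(x, True)\<close> is the basis element \<open>x\<close>, and \<open>(x, False)\<close> is its inverse.\<close>

definition free_group_rels :: "'x set \<Rightarrow> (('x \<times> bool) list \<times> ('x \<times> bool) list) set" where
  "free_group_rels X = {([(x, b), (x, \<not> b)], []) | x b. x \<in> X}"

definition free_group :: "'x set \<Rightarrow> ('x \<times> bool) list set monoid" where
  "free_group X = presented_monoid (X \<times> UNIV) (free_group_rels X)"

definition free_group_lift :: "('k, 'm) monoid_scheme \<Rightarrow> ('x \<Rightarrow> 'k) \<Rightarrow> ('x \<times> bool) list set \<Rightarrow> 'k" where
  "free_group_lift K \<gamma> = word_lift K (\<lambda>(x, b). if b then \<gamma> x else inv\<^bsub>K\<^esub> (\<gamma> x))"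

definition free_product_rels ::
  "('a, 'm) monoid_scheme \<Rightarrow> ('b, 'n) monoid_scheme \<Rightarrow> (('a + 'b) list \<times> ('a + 'b) list) set" where
  "free_product_rels G H =
     {([Inl x, Inl y], [Inl (x \<otimes>\<^bsub>G\<^esub> y)]) | x y. x \<in> carrier G \<and> y \<in> carrier G} \<union>
     {([Inr x, Inr y], [Inr (x \<otimes>\<^bsub>H\<^esub> y)]) | x y. x \<in> carrier H \<and> y \<in> carrier H} \<union>
     {([Inl \<one>\<^bsub>G\<^esub>], []), ([Inr \<one>\<^bsub>H\<^esub>], [])}"

definition free_product ::
  "('a, 'm) monoid_scheme \<Rightarrow> ('b, 'n) monoid_scheme \<Rightarrow> ('a + 'b) list set monoid" where
  "free_product G H = presented_monoid (Inl ` carrier G \<union> Inr ` carrier H) (free_product_rels G H)"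

definition free_product_inl ::
  "('a, 'm) monoid_scheme \<Rightarrow> ('b, 'n) monoid_scheme \<Rightarrow> 'a \<Rightarrow> ('a + 'b) list set" where
  "free_product_inl G H x = word_class (Inl ` carrier G \<union> Inr ` carrier H) (free_product_rels G H) [Inl x]"

definition free_product_lift ::
  "('k, 'm) monoid_scheme \<Rightarrow> ('a \<Rightarrow> 'k) \<Rightarrow> ('b \<Rightarrow> 'k) \<Rightarrow> ('a + 'b) list set \<Rightarrow> 'k" where
  "free_product_lift K p q = word_lift K (case_sum p q)"


section \<open>Mixed identities\<close>

definition word_subst ::
  "('a, 'm) monoid_scheme \<Rightarrow> (nat \<Rightarrow> 'a) \<Rightarrow> ('a + (nat \<times> bool) list set) list set \<Rightarrow> 'a" where
  "word_subst G \<gamma> = free_product_lift G (\<lambda>g. g) (free_group_lift G \<gamma>)"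

definition mixed_identity ::
  "('a, 'm) monoid_scheme \<Rightarrow> nat \<Rightarrow> ('a + (nat \<times> bool) list set) list set \<Rightarrow> bool" where
  "mixed_identity G n w \<longleftrightarrow>
     w \<in> carrier (free_product G (free_group {..<n})) \<and>
     (\<forall>\<gamma> \<in> {..<n} \<rightarrow> carrier G. word_subst G \<gamma> w = \<one>\<^bsub>G\<^esub>)"

definition mixed_identity_free :: "('a, 'm) monoid_scheme \<Rightarrow> bool" where
  "mixed_identity_free G \<longleftrightarrow>
     (\<forall>n\<ge>1. \<forall>w. mixed_identity G n w \<longrightarrow> w = \<one>\<^bsub>free_product G (free_group {..<n})\<^esub>)"


section \<open>2-transitive actions\<close>

definition two_transitive_action ::
  "('a, 'm) monoid_scheme \<Rightarrow> 'x set \<Rightarrow> ('a \<Rightarrow> 'x \<Rightarrow> 'x) \<Rightarrow> bool" where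
  "two_transitive_action G X \<phi> \<longleftrightarrow>
     group_action G X \<phi> \<and>
     (\<exists>x\<in>X. \<exists>y\<in>X. x \<noteq> y) \<and>
     (\<forall>x\<in>X. \<forall>y\<in>X. \<forall>x'\<in>X. \<forall>y'\<in>X. x \<noteq> y \<longrightarrow> x' \<noteq> y' \<longrightarrow>
        (\<exists>g\<in>carrier G. \<phi> g x = x' \<and> \<phi> g y = y'))"


section \<open>Group-theoretic properties\<close>

definition torsion_free :: "('a, 'm) monoid_scheme \<Rightarrow> bool" where
  "torsion_free G \<longleftrightarrow> (\<forall>x\<in>carrier G. \<forall>n::nat. n > 0 \<longrightarrow> x [^]\<^bsub>G\<^esub> n = \<one>\<^bsub>G\<^esub> \<longrightarrow> x = \<one>\<^bsub>G\<^esub>)"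

definition finite_gen_set :: "('a, 'm) monoid_scheme \<Rightarrow> 'a set \<Rightarrow> bool" where
  "finite_gen_set G S \<longleftrightarrow> finite S \<and> S \<subseteq> carrier G \<and> generate G S = carrier G"

definition finitely_generated :: "('a, 'm) monoid_scheme \<Rightarrow> bool" where
  "finitely_generated G \<longleftrightarrow> (\<exists>S. finite_gen_set G S)"

text \<open>Simplicity is spelled out here because the library locale \<open>simple_group\<close> only covers finite
  groups: it demands \<open>order G > 1\<close>, where the order of an infinite group is \<open>0\<close>.\<close>

definition is_simple :: "('a, 'm) monoid_scheme \<Rightarrow> bool" where
  "is_simple G \<longleftrightarrow> group G \<and> carrier G \<noteq> {\<one>\<^bsub>G\<^esub>} \<and>
     (\<forall>N. N \<lhd> G \<longrightarrow> N = carrier G \<or> N = {\<one>\<^bsub>G\<^esub>})"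

definition torsion_free_tarski_monster :: "('a, 'm) monoid_scheme \<Rightarrow> bool" where
  "torsion_free_tarski_monster G \<longleftrightarrow>
     group G \<and> torsion_free G \<and> finitely_generated G \<and> \<not> comm_group G \<and>
     (\<forall>H. subgroup H G \<longrightarrow> H \<noteq> carrier G \<longrightarrow> H \<noteq> {\<one>\<^bsub>G\<^esub>} \<longrightarrow>
        infinite H \<and> cyclic_group (G\<lparr>carrier := H\<rparr>))"

text \<open>Elementary means virtually cyclic; finite groups are included via \<open>H = {\<one>}\<close>.\<close>

definition elementary :: "('a, 'm) monoid_scheme \<Rightarrow> bool" where
  "elementary G \<longleftrightarrow>
     (\<exists>H. subgroup H G \<and> cyclic_group (G\<lparr>carrier := H\<rparr>) \<and> finite (rcosets\<^bsub>G\<^esub> H))"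


section \<open>Word metrics and hyperbolic groups\<close>

definition word_length :: "('a, 'm) monoid_scheme \<Rightarrow> 'a set \<Rightarrow> 'a \<Rightarrow> nat" where
  "word_length G S x =
     (LEAST n. \<exists>w. length w = n \<and> set w \<subseteq> S \<union> m_inv G ` S \<and> word_eval G (\<lambda>s. s) w = x)"

definition word_dist :: "('a, 'm) monoid_scheme \<Rightarrow> 'a set \<Rightarrow> 'a \<Rightarrow> 'a \<Rightarrow> real" where
  "word_dist G S x y = real (word_length G S (inv\<^bsub>G\<^esub> x \<otimes>\<^bsub>G\<^esub> y))"

definition gromov_product :: "('a \<Rightarrow> 'a \<Rightarrow> real) \<Rightarrow> 'a \<Rightarrow> 'a \<Rightarrow> 'a \<Rightarrow> real" where
  "gromov_product d w x y = (d x w + d y w - d x y) / 2"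

definition gromov_hyperbolic :: "'a set \<Rightarrow> ('a \<Rightarrow> 'a \<Rightarrow> real) \<Rightarrow> bool" where
  "gromov_hyperbolic M d \<longleftrightarrow>
     (\<exists>\<delta>\<ge>0. \<forall>w\<in>M. \<forall>x\<in>M. \<forall>y\<in>M. \<forall>z\<in>M.
        gromov_product d w x z \<ge> min (gromov_product d w x y) (gromov_product d w y z) - \<delta>)"

definition hyperbolic_group :: "('a, 'm) monoid_scheme \<Rightarrow> bool" where
  "hyperbolic_group G \<longleftrightarrow>
     group G \<and> (\<exists>S. finite_gen_set G S \<and> gromov_hyperbolic (carrier G) (word_dist G S))"


section \<open>Asymptotic cones and lacunary hyperbolic groups\<close>

definition nonprincipal_ultrafilter :: "nat filter \<Rightarrow> bool" where
  "nonprincipal_ultrafilter \<omega> \<longleftrightarrow>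
     \<omega> \<noteq> bot \<and> \<omega> \<le> sequentially \<and>
     (\<forall>P. eventually P \<omega> \<or> eventually (\<lambda>n. \<not> P n) \<omega>)"

text \<open>The cone of \<open>(M, d)\<close> with constant observation point \<open>e\<close> and scaling sequence \<open>s\<close>.\<close>

definition cone_seqs ::
  "'a set \<Rightarrow> ('a \<Rightarrow> 'a \<Rightarrow> real) \<Rightarrow> 'a \<Rightarrow> (nat \<Rightarrow> real) \<Rightarrow> nat filter \<Rightarrow> (nat \<Rightarrow> 'a) set" where
  "cone_seqs M d e s \<omega> =
     {x. (\<forall>n. x n \<in> M) \<and> (\<exists>C. eventually (\<lambda>n. d e (x n) / s n \<le> C) \<omega>)}"

definition cone_rel ::
  "'a set \<Rightarrow> ('a \<Rightarrow> 'a \<Rightarrow> real) \<Rightarrow> 'a \<Rightarrow> (nat \<Rightarrow> real) \<Rightarrow> nat filter \<Rightarrow>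
     ((nat \<Rightarrow> 'a) \<times> (nat \<Rightarrow> 'a)) set" where
  "cone_rel M d e s \<omega> =
     {(x, y). x \<in> cone_seqs M d e s \<omega> \<and> y \<in> cone_seqs M d e s \<omega> \<and>
              ((\<lambda>n. d (x n) (y n) / s n) \<longlongrightarrow> 0) \<omega>}"

definition asymptotic_cone ::
  "'a set \<Rightarrow> ('a \<Rightarrow> 'a \<Rightarrow> real) \<Rightarrow> 'a \<Rightarrow> (nat \<Rightarrow> real) \<Rightarrow> nat filter \<Rightarrow> (nat \<Rightarrow> 'a) set set" where
  "asymptotic_cone M d e s \<omega> = cone_seqs M d e s \<omega> // cone_rel M d e s \<omega>"

text \<open>The value \<open>0\<close> off the cone is needed because \<^locale>\<open>Metric_space\<close> requires nonnegativity and
  symmetry on the whole type.\<close>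

definition cone_dist ::
  "'a set \<Rightarrow> ('a \<Rightarrow> 'a \<Rightarrow> real) \<Rightarrow> 'a \<Rightarrow> (nat \<Rightarrow> real) \<Rightarrow> nat filter \<Rightarrow>
     (nat \<Rightarrow> 'a) set \<Rightarrow> (nat \<Rightarrow> 'a) set \<Rightarrow> real" where
  "cone_dist M d e s \<omega> A B =
     (if A \<in> asymptotic_cone M d e s \<omega> \<and> B \<in> asymptotic_cone M d e s \<omega>
      then the_elem ((\<lambda>(x, y). Lim \<omega> (\<lambda>n. d (x n) (y n) / s n)) ` (A \<times> B))
      else 0)"

text \<open>An R-tree is a nonempty geodesic metric space in which any two arcs with the same endpoints
  have the same image.\<close>

definition geodesic_space :: "'a set \<Rightarrow> ('a \<Rightarrow> 'a \<Rightarrow> real) \<Rightarrow> bool" where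
  "geodesic_space M d \<longleftrightarrow>
     (\<forall>x\<in>M. \<forall>y\<in>M. \<exists>c. c ` {0..d x y} \<subseteq> M \<and> c 0 = x \<and> c (d x y) = y \<and>
        (\<forall>s\<in>{0..d x y}. \<forall>t\<in>{0..d x y}. d (c s) (c t) = \<bar>s - t\<bar>))"

definition arc_between :: "'a set \<Rightarrow> ('a \<Rightarrow> 'a \<Rightarrow> real) \<Rightarrow> (real \<Rightarrow> 'a) \<Rightarrow> 'a \<Rightarrow> 'a \<Rightarrow> bool" where
  "arc_between M d g x y \<longleftrightarrow>
     pathin (Metric_space.mtopology M d) g \<and> inj_on g {0..1} \<and> g 0 = x \<and> g 1 = y"

definition real_tree :: "'a set \<Rightarrow> ('a \<Rightarrow> 'a \<Rightarrow> real) \<Rightarrow> bool" where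
  "real_tree M d \<longleftrightarrow>
     Metric_space M d \<and> M \<noteq> {} \<and> geodesic_space M d \<and>
     (\<forall>x y g h. arc_between M d g x y \<longrightarrow> arc_between M d h x y \<longrightarrow> g ` {0..1} = h ` {0..1})"

definition lacunary_hyperbolic :: "('a, 'm) monoid_scheme \<Rightarrow> bool" where
  "lacunary_hyperbolic G \<longleftrightarrow>
     group G \<and>
     (\<exists>S s \<omega>. finite_gen_set G S \<and> (\<forall>n. s n > 0) \<and> filterlim s at_top sequentially \<and>
        nonprincipal_ultrafilter \<omega> \<and>
        real_tree (asymptotic_cone (carrier G) (word_dist G S) \<one>\<^bsub>G\<^esub> s \<omega>)
                  (cone_dist (carrier G) (word_dist G S) \<one>\<^bsub>G\<^esub> s \<omega>))"


section \<open>Norms\<close>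

definition group_norm :: "('a, 'm) monoid_scheme \<Rightarrow> ('a \<Rightarrow> ennreal) \<Rightarrow> bool" where
  "group_norm G N \<longleftrightarrow>
     (\<forall>x\<in>carrier G. N x = 0 \<longleftrightarrow> x = \<one>\<^bsub>G\<^esub>) \<and>
     (\<forall>x\<in>carrier G. N (inv\<^bsub>G\<^esub> x) = N x) \<and>
     (\<forall>x\<in>carrier G. \<forall>y\<in>carrier G. N (x \<otimes>\<^bsub>G\<^esub> y) \<le> N x + N y)"

definition trivial_norm :: "('a, 'm) monoid_scheme \<Rightarrow> ('a \<Rightarrow> ennreal) \<Rightarrow> bool" where
  "trivial_norm G N \<longleftrightarrow> (\<forall>x\<in>carrier G. N x = 0 \<or> N x = \<infinity>)"

definition conj_invariant_norm :: "('a, 'm) monoid_scheme \<Rightarrow> ('a \<Rightarrow> ennreal) \<Rightarrow> bool" where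
  "conj_invariant_norm G N \<longleftrightarrow>
     (\<forall>x\<in>carrier G. \<forall>y\<in>carrier G. N (x \<otimes>\<^bsub>G\<^esub> y \<otimes>\<^bsub>G\<^esub> inv\<^bsub>G\<^esub> x) = N y)"

definition stably_bounded :: "('a, 'm) monoid_scheme \<Rightarrow> ('a \<Rightarrow> ennreal) \<Rightarrow> bool" where
  "stably_bounded G N \<longleftrightarrow>
     (\<forall>x\<in>carrier G. liminf (\<lambda>n::nat. N (x [^]\<^bsub>G\<^esub> n) / of_nat n) = 0)"


section \<open>First-order formulas in the language of groups\<close>

datatype gterm = Var nat | Unit | Inv gterm | Times gterm gterm

datatype gformula =
    Eq gterm gterm
  | Neg gformula
  | Conj gformula gformula
  | Disj gformula gformula
  | Forall nat gformula
  | Exists nat gformula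

primrec term_vars :: "gterm \<Rightarrow> nat set" where
  "term_vars (Var i) = {i}"
| "term_vars Unit = {}"
| "term_vars (Inv t) = term_vars t"
| "term_vars (Times s t) = term_vars s \<union> term_vars t"

primrec free_vars :: "gformula \<Rightarrow> nat set" where
  "free_vars (Eq s t) = term_vars s \<union> term_vars t"
| "free_vars (Neg \<phi>) = free_vars \<phi>"
| "free_vars (Conj \<phi> \<psi>) = free_vars \<phi> \<union> free_vars \<psi>"
| "free_vars (Disj \<phi> \<psi>) = free_vars \<phi> \<union> free_vars \<psi>"
| "free_vars (Forall i \<phi>) = free_vars \<phi> - {i}"
| "free_vars (Exists i \<phi>) = free_vars \<phi> - {i}"

primrec quantifier_free :: "gformula \<Rightarrow> bool" where
  "quantifier_free (Eq s t) = True"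
| "quantifier_free (Neg \<phi>) = quantifier_free \<phi>"
| "quantifier_free (Conj \<phi> \<psi>) = (quantifier_free \<phi> \<and> quantifier_free \<psi>)"
| "quantifier_free (Disj \<phi> \<psi>) = (quantifier_free \<phi> \<and> quantifier_free \<psi>)"
| "quantifier_free (Forall i \<phi>) = False"
| "quantifier_free (Exists i \<phi>) = False"

primrec term_val :: "('a, 'm) monoid_scheme \<Rightarrow> (nat \<Rightarrow> 'a) \<Rightarrow> gterm \<Rightarrow> 'a" where
  "term_val G e (Var i) = e i"
| "term_val G e Unit = \<one>\<^bsub>G\<^esub>"
| "term_val G e (Inv t) = inv\<^bsub>G\<^esub> (term_val G e t)"
| "term_val G e (Times s t) = term_val G e s \<otimes>\<^bsub>G\<^esub> term_val G e t"

primrec holds :: "('a, 'm) monoid_scheme \<Rightarrow> (nat \<Rightarrow> 'a) \<Rightarrow> gformula \<Rightarrow> bool" where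
  "holds G e (Eq s t) \<longleftrightarrow> term_val G e s = term_val G e t"
| "holds G e (Neg \<phi>) \<longleftrightarrow> \<not> holds G e \<phi>"
| "holds G e (Conj \<phi> \<psi>) \<longleftrightarrow> holds G e \<phi> \<and> holds G e \<psi>"
| "holds G e (Disj \<phi> \<psi>) \<longleftrightarrow> holds G e \<phi> \<or> holds G e \<psi>"
| "holds G e (Forall i \<phi>) \<longleftrightarrow> (\<forall>a\<in>carrier G. holds G (e(i := a)) \<phi>)"
| "holds G e (Exists i \<phi>) \<longleftrightarrow> (\<exists>a\<in>carrier G. holds G (e(i := a)) \<phi>)"

definition Alls :: "nat list \<Rightarrow> gformula \<Rightarrow> gformula" where
  "Alls xs \<phi> = foldr Forall xs \<phi>"

definition Exs :: "nat list \<Rightarrow> gformula \<Rightarrow> gformula" where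
  "Exs xs \<phi> = foldr Exists xs \<phi>"

text \<open>The free variables \<open>\<^bold>z\<close> of a formula applied to a tuple \<open>\<gamma>\<close> of arity \<open>m\<close> are the variables
  \<open>0, \<dots>, m - 1\<close>, and variable \<open>i\<close> is interpreted as the \<open>i\<close>-th entry of \<open>\<gamma>\<close>.\<close>

definition tuple_env :: "('a, 'm) monoid_scheme \<Rightarrow> 'a list \<Rightarrow> nat \<Rightarrow> 'a" where
  "tuple_env G \<gamma> i = (if i < length \<gamma> then \<gamma> ! i else \<one>\<^bsub>G\<^esub>)"

definition Th_AE :: "('a, 'm) monoid_scheme \<Rightarrow> 'a list \<Rightarrow> gformula set" where
  "Th_AE G \<gamma> = {\<Sigma>. (\<exists>xs ys \<phi>. \<Sigma> = Alls xs (Exs ys \<phi>) \<and> quantifier_free \<phi>) \<and>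
                    free_vars \<Sigma> \<subseteq> {..<length \<gamma>} \<and> holds G (tuple_env G \<gamma>) \<Sigma>}"

definition Th_EAE :: "('a, 'm) monoid_scheme \<Rightarrow> 'a list \<Rightarrow> gformula set" where
  "Th_EAE G \<gamma> = {\<Sigma>. (\<exists>xs ys ts \<phi>. \<Sigma> = Exs xs (Alls ys (Exs ts \<phi>)) \<and> quantifier_free \<phi>) \<and>
                     free_vars \<Sigma> \<subseteq> {..<length \<gamma>} \<and> holds G (tuple_env G \<gamma>) \<Sigma>}"

definition set_lim :: "(nat \<Rightarrow> 'c set) \<Rightarrow> 'c set \<Rightarrow> bool" where
  "set_lim A L \<longleftrightarrow> (\<Union>k. \<Inter>j\<in>{k..}. A j) = L \<and> (\<Inter>k. \<Union>j\<in>{k..}. A j) = L"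

definition EAE_embeds_free_product_Z :: "('a, 'm) monoid_scheme \<Rightarrow> bool" where
  "EAE_embeds_free_product_Z G \<longleftrightarrow>
     (\<forall>\<gamma>. set \<gamma> \<subseteq> carrier G \<longrightarrow>
        Th_EAE G \<gamma> \<subseteq>
        Th_EAE (free_product G integer_group) (map (free_product_inl G integer_group) \<gamma>))"


section \<open>Direct limits of sequences of groups\<close>

text \<open>For maps \<open>f k : G k \<rightarrow> G (k + 1)\<close>, \<open>transition f i j\<close> is the composite \<open>G i \<rightarrow> G j\<close> if
  \<open>i \<le> j\<close> (and is not used otherwise).\<close>

primrec iter_map :: "(nat \<Rightarrow> 'a \<Rightarrow> 'a) \<Rightarrow> nat \<Rightarrow> nat \<Rightarrow> 'a \<Rightarrow> 'a" where
  "iter_map f i 0 x = x"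
| "iter_map f i (Suc n) x = f (i + n) (iter_map f i n x)"

definition transition :: "(nat \<Rightarrow> 'a \<Rightarrow> 'a) \<Rightarrow> nat \<Rightarrow> nat \<Rightarrow> 'a \<Rightarrow> 'a" where
  "transition f i j = iter_map f i (j - i)"

definition dlim_rel :: "(nat \<Rightarrow> 'a monoid) \<Rightarrow> (nat \<Rightarrow> 'a \<Rightarrow> 'a) \<Rightarrow> ((nat \<times> 'a) \<times> (nat \<times> 'a)) set" where
  "dlim_rel G f = {((i, x), (j, y)). x \<in> carrier (G i) \<and> y \<in> carrier (G j) \<and>
                     (\<exists>k. i \<le> k \<and> j \<le> k \<and> transition f i k x = transition f j k y)}"

definition dlim_map :: "(nat \<Rightarrow> 'a monoid) \<Rightarrow> (nat \<Rightarrow> 'a \<Rightarrow> 'a) \<Rightarrow> nat \<Rightarrow> 'a \<Rightarrow> (nat \<times> 'a) set" where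
  "dlim_map G f i x = dlim_rel G f `` {(i, x)}"

definition direct_limit :: "(nat \<Rightarrow> 'a monoid) \<Rightarrow> (nat \<Rightarrow> 'a \<Rightarrow> 'a) \<Rightarrow> (nat \<times> 'a) set monoid" where
  "direct_limit G f =
     \<lparr>carrier = (SIGMA i:UNIV. carrier (G i)) // dlim_rel G f,
      monoid.mult = (\<lambda>A B. \<Union>(i, x)\<in>A. \<Union>(j, y)\<in>B.
                dlim_map G f (max i j)
                  (transition f i (max i j) x \<otimes>\<^bsub>G (max i j)\<^esub> transition f j (max i j) y)),
      one = dlim_map G f 0 \<one>\<^bsub>G 0\<^esub>\<rparr>"


section \<open>The constructions are well defined\<close>

subsection \<open>Free groups, free products and lifts\<close>

lemma word_cong_lists:
  assumes "word_cong L R v w" and R: "R \<subseteq> lists L \<times> lists L"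
  shows "v \<in> lists L \<and> w \<in> lists L"
  using assms(1) by (induction) (use R in auto)

lemma word_cong_append:
  assumes "word_cong L R v w" "p \<in> lists L" "q \<in> lists L"
  shows "word_cong L R (p @ v @ q) (p @ w @ q)"
  using assms
proof (induction)
  case (base l r u v)
  then have "word_cong L R ((p @ u) @ l @ (v @ q)) ((p @ u) @ r @ (v @ q))"
    by (intro word_cong.base) auto
  then show ?case by simp
next
  case (refl w) then show ?case by (intro word_cong.refl) auto
qed (auto intro: word_cong.sym word_cong.trans)

lemma word_cong_append2:
  assumes "word_cong L R v w" "word_cong L R v' w'" and R: "R \<subseteq> lists L \<times> lists L"
  shows "word_cong L R (v @ v') (w @ w')"
  using word_cong_append[OF assms(1), of "[]" v'] word_cong_append[OF assms(2), of w "[]"]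
    word_cong_lists[OF assms(1) R] word_cong_lists[OF assms(2) R]
  by (auto elim: word_cong.trans)

lemma word_class_eq_iff:
  assumes "w \<in> lists L"
  shows "word_class L R v = word_class L R w \<longleftrightarrow> word_cong L R v w"
  using assms unfolding word_class_def by (auto intro: word_cong.intros)

lemma presented_mult:
  assumes R: "R \<subseteq> lists L \<times> lists L" and "v \<in> lists L" "w \<in> lists L"
  shows "word_class L R v \<otimes>\<^bsub>presented_monoid L R\<^esub> word_class L R w = word_class L R (v @ w)"
proof -
  have "word_class L R (a @ b) = word_class L R (v @ w)"
    if "a \<in> word_class L R v" "b \<in> word_class L R w" for a b
    using that assms word_cong.sym[OF word_cong_append2[OF _ _ R, of v a w b]]
    by (subst word_class_eq_iff) (auto simp: word_class_def)
  moreover have "v \<in> word_class L R v" "w \<in> word_class L R w"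
    using assms by (auto simp: word_class_def intro: word_cong.refl)
  ultimately have "(\<Union>a\<in>word_class L R v. \<Union>b\<in>word_class L R w. word_class L R (a @ b)) = word_class L R (v @ w)"
    by blast
  then show ?thesis by (simp add: presented_monoid_def)
qed

lemma presented_monoid_monoid:
  assumes R: "R \<subseteq> lists L \<times> lists L"
  shows "monoid (presented_monoid L R)" (is "monoid ?P")
proof (rule monoidI)
  have c: "carrier ?P = word_class L R ` lists L" and o: "\<one>\<^bsub>?P\<^esub> = word_class L R []"
    by (auto simp: presented_monoid_def)
  note m = presented_mult[OF R]
  have app: "u @ v \<in> lists L" if "u \<in> lists L" "v \<in> lists L" for u v
    using that by simp
  show "\<one>\<^bsub>?P\<^esub> \<in> carrier ?P" unfolding c o by blast
  fix x assume "x \<in> carrier ?P"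
  then obtain u where u: "u \<in> lists L" "x = word_class L R u" unfolding c by blast
  show "\<one>\<^bsub>?P\<^esub> \<otimes>\<^bsub>?P\<^esub> x = x" unfolding o u(2) using m[of "[]" u] u(1) by simp
  show "x \<otimes>\<^bsub>?P\<^esub> \<one>\<^bsub>?P\<^esub> = x" unfolding o u(2) using m[of u "[]"] u(1) by simp
  fix y assume "y \<in> carrier ?P"
  then obtain v where v: "v \<in> lists L" "y = word_class L R v" unfolding c by blast
  show "x \<otimes>\<^bsub>?P\<^esub> y \<in> carrier ?P"
    unfolding u(2) v(2) m[OF u(1) v(1)] c using app[OF u(1) v(1)] by blast
  fix z assume "z \<in> carrier ?P"
  then obtain w where w: "w \<in> lists L" "z = word_class L R w" unfolding c by blast
  show "x \<otimes>\<^bsub>?P\<^esub> y \<otimes>\<^bsub>?P\<^esub> z = x \<otimes>\<^bsub>?P\<^esub> (y \<otimes>\<^bsub>?P\<^esub> z)"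
    unfolding u(2) v(2) w(2) m[OF u(1) v(1)] m[OF v(1) w(1)]
      m[OF app[OF u(1) v(1)] w(1)] m[OF u(1) app[OF v(1) w(1)]] by simp
qed

lemma presented_monoid_group:
  assumes R: "R \<subseteq> lists L \<times> lists L"
    and inv: "\<And>l. l \<in> L \<Longrightarrow> \<exists>l'\<in>L. word_cong L R [l', l] []"
  shows "group (presented_monoid L R)"
proof -
  interpret monoid "presented_monoid L R" by (rule presented_monoid_monoid[OF R])
  have ex: "\<exists>v\<in>lists L. word_cong L R (v @ w) []" if "w \<in> lists L" for w
    using that
  proof (induction w)
    case Nil
    have "word_cong L R [] []" by (rule word_cong.refl) simp
    then show ?case by (intro bexI[of _ "[]"]) auto
  next
    case (Cons l w)
    then obtain v where v: "v \<in> lists L" "word_cong L R (v @ w) []" by auto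
    from Cons have "l \<in> L" by auto
    then obtain l' where l': "l' \<in> L" "word_cong L R [l', l] []" using inv by blast
    have "word_cong L R (v @ [l', l] @ w) (v @ [] @ w)"
      using v l' Cons by (intro word_cong_append) auto
    then have "word_cong L R ((v @ [l']) @ l # w) []" using word_cong.trans[OF _ v(2)] by simp
    then show ?case using v l' by (intro bexI[of _ "v @ [l']"]) auto
  qed
  show ?thesis
  proof (rule group_l_invI)
    fix x assume "x \<in> carrier (presented_monoid L R)"
    then obtain w where w: "w \<in> lists L" "x = word_class L R w" by (auto simp: presented_monoid_def)
    obtain v where v: "v \<in> lists L" "word_cong L R (v @ w) []" using ex w(1) by blast
    show "\<exists>y\<in>carrier (presented_monoid L R). y \<otimes>\<^bsub>presented_monoid L R\<^esub> x = \<one>\<^bsub>presented_monoid L R\<^esub>"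
      using v w presented_mult[OF R v(1) w(1)]
      by (intro bexI[of _ "word_class L R v"]) (auto simp: presented_monoid_def word_class_eq_iff)
  qed
qed

lemma free_group_group: "group (free_group X)"
  unfolding free_group_def
proof (rule presented_monoid_group)
  show "free_group_rels X \<subseteq> lists (X \<times> UNIV) \<times> lists (X \<times> UNIV)"
    by (auto simp: free_group_rels_def)
  fix l assume "l \<in> X \<times> (UNIV :: bool set)"
  then obtain x b where l: "l = (x, b)" "x \<in> X" by auto
  have "word_cong (X \<times> UNIV) (free_group_rels X) ([] @ [(x, \<not> b), (x, b)] @ []) ([] @ [] @ [])"
    using l by (intro word_cong.base) (auto simp: free_group_rels_def)
  then show "\<exists>l'\<in>X \<times> UNIV. word_cong (X \<times> UNIV) (free_group_rels X) [l', l] []"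
    using l by (intro bexI[of _ "(x, \<not> b)"]) auto
qed

lemma free_product_rels_lists:
  assumes "group G" "group H"
  shows "free_product_rels G H \<subseteq> lists (Inl ` carrier G \<union> Inr ` carrier H) \<times> lists (Inl ` carrier G \<union> Inr ` carrier H)"
proof -
  interpret G: group G by fact
  interpret H: group H by fact
  show ?thesis by (auto simp: free_product_rels_def)
qed

lemma free_product_group:
  assumes "group G" "group H"
  shows "group (free_product G H)"
proof -
  interpret G: group G by fact
  interpret H: group H by fact
  let ?L = "Inl ` carrier G \<union> Inr ` carrier H"
  let ?R = "free_product_rels G H"
  show ?thesis unfolding free_product_def
  proof (rule presented_monoid_group)
    show "?R \<subseteq> lists ?L \<times> lists ?L" by (rule free_product_rels_lists[OF assms])
    fix l assume "l \<in> ?L"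
    then consider x where "l = Inl x" "x \<in> carrier G" | x where "l = Inr x" "x \<in> carrier H" by auto
    then show "\<exists>l'\<in>?L. word_cong ?L ?R [l', l] []"
    proof cases
      case 1
      have "word_cong ?L ?R ([] @ [Inl (inv\<^bsub>G\<^esub> x), Inl x] @ []) ([] @ [Inl (inv\<^bsub>G\<^esub> x \<otimes>\<^bsub>G\<^esub> x)] @ [])"
        using 1 by (intro word_cong.base) (auto simp: free_product_rels_def)
      moreover have "word_cong ?L ?R ([] @ [Inl \<one>\<^bsub>G\<^esub>] @ []) ([] @ [] @ [])"
        by (intro word_cong.base) (auto simp: free_product_rels_def)
      ultimately have "word_cong ?L ?R [Inl (inv\<^bsub>G\<^esub> x), Inl x] []"
        using 1 word_cong.trans by fastforce
      then show ?thesis using 1 by (intro bexI[of _ "Inl (inv\<^bsub>G\<^esub> x)"]) auto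
    next
      case 2
      have "word_cong ?L ?R ([] @ [Inr (inv\<^bsub>H\<^esub> x), Inr x] @ []) ([] @ [Inr (inv\<^bsub>H\<^esub> x \<otimes>\<^bsub>H\<^esub> x)] @ [])"
        using 2 by (intro word_cong.base) (auto simp: free_product_rels_def)
      moreover have "word_cong ?L ?R ([] @ [Inr \<one>\<^bsub>H\<^esub>] @ []) ([] @ [] @ [])"
        by (intro word_cong.base) (auto simp: free_product_rels_def)
      ultimately have "word_cong ?L ?R [Inr (inv\<^bsub>H\<^esub> x), Inr x] []"
        using 2 word_cong.trans by fastforce
      then show ?thesis using 2 by (intro bexI[of _ "Inr (inv\<^bsub>H\<^esub> x)"]) auto
    qed
  qed
qed

lemma word_eval_append:
  assumes "group K" "\<And>l. l \<in> L \<Longrightarrow> h l \<in> carrier K" "u \<in> lists L" "v \<in> lists L"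
  shows "word_eval K h u \<in> carrier K \<and> word_eval K h (u @ v) = word_eval K h u \<otimes>\<^bsub>K\<^esub> word_eval K h v"
proof -
  interpret group K by fact
  have cl: "word_eval K h w \<in> carrier K" if "w \<in> lists L" for w
    using that by (induction w) (auto simp: word_eval_def assms(2))
  show ?thesis using assms(3)
  proof (induction u)
    case Nil then show ?case using cl[OF assms(4)] by (simp add: word_eval_def)
  next
    case (Cons a u)
    then show ?case using cl[OF assms(4)] assms(2)[of a] by (auto simp: word_eval_def m_assoc)
  qed
qed

lemma word_eval_cong:
  assumes K: "group K" and h: "\<And>l. l \<in> L \<Longrightarrow> h l \<in> carrier K" and R: "R \<subseteq> lists L \<times> lists L"
    and resp: "\<And>l r. (l, r) \<in> R \<Longrightarrow> word_eval K h l = word_eval K h r"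
    and "word_cong L R v w"
  shows "word_eval K h v = word_eval K h w"
  using assms(5)
proof induction
  case (base l r u v)
  have lr: "l \<in> lists L" "r \<in> lists L" using base R by auto
  have A: "word_eval K h (a @ b) = word_eval K h a \<otimes>\<^bsub>K\<^esub> word_eval K h b"
    if "a \<in> lists L" "b \<in> lists L" for a b
    using word_eval_append[of K L h, OF K h that] by blast
  have "l @ v \<in> lists L" "r @ v \<in> lists L" using lr base by auto
  then show ?case using A[of u "l @ v"] A[of l v] A[of u "r @ v"] A[of r v] lr base resp[OF base(1)] by simp
qed auto

lemma word_lift_class:
  assumes K: "group K" and h: "\<And>l. l \<in> L \<Longrightarrow> h l \<in> carrier K" and R: "R \<subseteq> lists L \<times> lists L"
    and resp: "\<And>l r. (l, r) \<in> R \<Longrightarrow> word_eval K h l = word_eval K h r"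
    and w: "w \<in> lists L"
  shows "word_lift K h (word_class L R w) = word_eval K h w"
proof -
  have "word_eval K h ` word_class L R w = {word_eval K h w}"
    using word_eval_cong[OF K h R resp] w
    by (auto simp: word_class_def intro!: image_eqI[OF _ CollectI, of _ _ w] word_cong.refl)
  then show ?thesis by (simp add: word_lift_def)
qed

lemma free_group_lift_class:
  assumes K: "group K" and g: "\<gamma> \<in> X \<rightarrow> carrier K" and w: "w \<in> lists (X \<times> UNIV)"
  shows "free_group_lift K \<gamma> (word_class (X \<times> UNIV) (free_group_rels X) w) =
    word_eval K (\<lambda>(x, b). if b then \<gamma> x else inv\<^bsub>K\<^esub> (\<gamma> x)) w"
proof -
  interpret group K by fact
  show ?thesis unfolding free_group_lift_def
    by (rule word_lift_class[OF K]) (use g w in \<open>auto simp: free_group_rels_def word_eval_def Pi_iff\<close>)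
qed

lemma free_product_lift_class:
  assumes "group G" "group H" and K: "group K" and p: "p \<in> hom G K" and q: "q \<in> hom H K"
    and w: "w \<in> lists (Inl ` carrier G \<union> Inr ` carrier H)"
  shows "free_product_lift K p q
     (word_class (Inl ` carrier G \<union> Inr ` carrier H) (free_product_rels G H) w) =
    word_eval K (case_sum p q) w"
proof -
  interpret K: group K by fact
  interpret p: group_hom G K p using assms by (simp add: group_hom_def group_hom_axioms_def)
  interpret q: group_hom H K q using assms by (simp add: group_hom_def group_hom_axioms_def)
  show ?thesis unfolding free_product_lift_def
    by (rule word_lift_class[OF K _ free_product_rels_lists[OF assms(1,2)] _ w])
      (auto simp: free_product_rels_def word_eval_def K.m_assoc)
qed

subsection \<open>Direct limits\<close>

lemma iter_map_add: "iter_map f i (m + n) x = iter_map f (i + m) n (iter_map f i m x)"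
  by (induction n) (auto simp: add.assoc)

lemma transition_trans:
  assumes "i \<le> j" "j \<le> k"
  shows "transition f j k (transition f i j x) = transition f i k x"
  using iter_map_add[of f i "j - i" "k - j" x] assms by (simp add: transition_def)

lemma transition_hom:
  assumes "\<And>k. f k \<in> hom (G k) (G (Suc k))" "i \<le> j"
  shows "transition f i j \<in> hom (G i) (G j)"
proof -
  have "iter_map f i n \<in> hom (G i) (G (i + n))" for n
  proof (induction n)
    case 0 then show ?case by (auto simp: hom_def)
  next
    case (Suc n) then show ?case using assms(1)[of "i + n"] by (auto simp: hom_def Pi_iff)
  qed
  from this[of "j - i"] show ?thesis using assms(2) by (simp add: transition_def)
qed

lemma dlim_rel_equiv:
  "equiv (SIGMA i:UNIV. carrier (G i)) (dlim_rel G f)"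
proof (rule equivI)
  show "dlim_rel G f \<subseteq> (SIGMA i:UNIV. carrier (G i)) \<times> (SIGMA i:UNIV. carrier (G i))"
    by (auto simp: dlim_rel_def)
  show "refl_on (SIGMA i:UNIV. carrier (G i)) (dlim_rel G f)"
    by (auto simp: dlim_rel_def refl_on_def)
  show "sym (dlim_rel G f)" unfolding sym_def dlim_rel_def by fastforce
  show "trans (dlim_rel G f)"
  proof (rule transI)
    fix p q r assume "(p, q) \<in> dlim_rel G f" "(q, r) \<in> dlim_rel G f"
    then obtain i x j y l z k m where *: "p = (i, x)" "q = (j, y)" "r = (l, z)"
      "x \<in> carrier (G i)" "z \<in> carrier (G l)" "i \<le> k" "j \<le> k" "j \<le> m" "l \<le> m"
      "transition f i k x = transition f j k y" "transition f j m y = transition f l m z"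
      unfolding dlim_rel_def by blast
    have "transition f i (max k m) x = transition f l (max k m) z"
      using *(6-11) transition_trans[of i k "max k m" f x] transition_trans[of j k "max k m" f y]
        transition_trans[of j m "max k m" f y] transition_trans[of l m "max k m" f z] by simp
    with * show "(p, r) \<in> dlim_rel G f" unfolding dlim_rel_def
      by (auto intro!: exI[of _ "max k m"])
  qed
qed

lemma dlim_map_eq_iff:
  assumes "x \<in> carrier (G i)" "y \<in> carrier (G j)"
  shows "dlim_map G f i x = dlim_map G f j y \<longleftrightarrow>
    (\<exists>k. i \<le> k \<and> j \<le> k \<and> transition f i k x = transition f j k y)"
  using eq_equiv_class_iff[OF dlim_rel_equiv[of G f], of "(i, x)" "(j, y)"] assms
  unfolding dlim_map_def by (auto simp: dlim_rel_def)

lemma UN2_const: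
  assumes "p \<in> A" "q \<in> B" "\<And>i x j y. (i, x) \<in> A \<Longrightarrow> (j, y) \<in> B \<Longrightarrow> F i x j y = C"
  shows "(\<Union>(i, x)\<in>A. \<Union>(j, y)\<in>B. F i x j y) = C"
  using assms by (auto; (cases p; cases q; fastforce)?)

lemma direct_limit_mult:
  assumes f: "\<And>k. f k \<in> hom (G k) (G (Suc k))" and x: "x \<in> carrier (G i)" and y: "y \<in> carrier (G j)"
    and g: "\<And>k. group (G k)" and k: "i \<le> k" "j \<le> k"
  shows "dlim_map G f i x \<otimes>\<^bsub>direct_limit G f\<^esub> dlim_map G f j y =
    dlim_map G f k (transition f i k x \<otimes>\<^bsub>G k\<^esub> transition f j k y)"
proof -
  note th = transition_hom[of f G, OF f]
  have tc: "transition f a b u \<in> carrier (G b)" if "a \<le> b" "u \<in> carrier (G a)" for a b u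
    using th[OF that(1)] that(2) by (auto simp: hom_def)
  have tm: "transition f a b (u \<otimes>\<^bsub>G a\<^esub> v) = transition f a b u \<otimes>\<^bsub>G b\<^esub> transition f a b v"
    if "a \<le> b" "u \<in> carrier (G a)" "v \<in> carrier (G a)" for a b u v
    using th[OF that(1)] that(2,3) by (auto simp: hom_def)
  have mc: "u \<otimes>\<^bsub>G a\<^esub> v \<in> carrier (G a)" if "u \<in> carrier (G a)" "v \<in> carrier (G a)" for a u v
    using g that by (simp add: group.is_monoid monoid.m_closed)
  have eq: "dlim_map G f (max i' j')
      (transition f i' (max i' j') x' \<otimes>\<^bsub>G (max i' j')\<^esub> transition f j' (max i' j') y') =
      dlim_map G f k (transition f i k x \<otimes>\<^bsub>G k\<^esub> transition f j k y)"
    if "(i', x') \<in> dlim_map G f i x" "(j', y') \<in> dlim_map G f j y" for i' x' j' y'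
  proof -
    from that(1) obtain a where a: "x' \<in> carrier (G i')" "i \<le> a" "i' \<le> a" "transition f i a x = transition f i' a x'"
      unfolding dlim_map_def dlim_rel_def by blast
    from that(2) obtain b where b: "y' \<in> carrier (G j')" "j \<le> b" "j' \<le> b" "transition f j b y = transition f j' b y'"
      unfolding dlim_map_def dlim_rel_def by blast
    define m where "m = max (max a b) k"
    have m: "a \<le> m" "b \<le> m" "k \<le> m" by (auto simp: m_def)
    have ij': "max i' j' \<le> m" using a b m by simp
    have X: "transition f i m x = transition f i' m x'"
      using transition_trans[OF a(2) m(1), of f x] transition_trans[OF a(3) m(1), of f x'] a(4) by simp
    have Y: "transition f j m y = transition f j' m y'"
      using transition_trans[OF b(2) m(2), of f y] transition_trans[OF b(3) m(2), of f y'] b(4) by simp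
    have "transition f (max i' j') m (transition f i' (max i' j') x' \<otimes>\<^bsub>G (max i' j')\<^esub> transition f j' (max i' j') y')
       = transition f i' m x' \<otimes>\<^bsub>G m\<^esub> transition f j' m y'"
      using tm[OF ij' tc[OF max.cobounded1 a(1)] tc[OF max.cobounded2 b(1)]]
        transition_trans[OF max.cobounded1 ij', of f x'] transition_trans[OF max.cobounded2 ij', of f y'] by simp
    moreover have "transition f k m (transition f i k x \<otimes>\<^bsub>G k\<^esub> transition f j k y)
       = transition f i m x \<otimes>\<^bsub>G m\<^esub> transition f j m y"
      using tm[OF m(3) tc[OF k(1) x] tc[OF k(2) y]]
        transition_trans[OF k(1) m(3), of f x] transition_trans[OF k(2) m(3), of f y] by simp
    ultimately show ?thesis
      using X Y ij' m(3)
        dlim_map_eq_iff[OF mc[OF tc[OF max.cobounded1 a(1)] tc[OF max.cobounded2 b(1)]] mc[OF tc[OF k(1) x] tc[OF k(2) y]], of f]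
      by metis
  qed
  have "(i, x) \<in> dlim_map G f i x" "(j, y) \<in> dlim_map G f j y"
    using x y by (auto simp: dlim_map_def dlim_rel_def)
  then have "(\<Union>(i', x')\<in>dlim_map G f i x. \<Union>(j', y')\<in>dlim_map G f j y. dlim_map G f (max i' j')
      (transition f i' (max i' j') x' \<otimes>\<^bsub>G (max i' j')\<^esub> transition f j' (max i' j') y')) =
      dlim_map G f k (transition f i k x \<otimes>\<^bsub>G k\<^esub> transition f j k y)"
    by (intro UN2_const) (use eq in auto)
  then show ?thesis by (simp add: direct_limit_def)
qed

lemma direct_limit_group:
  assumes f: "\<And>k. f k \<in> hom (G k) (G (Suc k))" and g: "\<And>k. group (G k)"
  shows "group (direct_limit G f)" (is "group ?D")
proof -
  note th = transition_hom[of f G, OF f]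
  note mult = direct_limit_mult[of f G, OF f _ _ g]
  have tc: "transition f a b u \<in> carrier (G b)" if "a \<le> b" "u \<in> carrier (G a)" for a b u
    using th[OF that(1)] that(2) by (auto simp: hom_def)
  have id: "transition f a a u = u" for a u by (simp add: transition_def)
  have c: "A \<in> carrier ?D \<longleftrightarrow> (\<exists>i x. x \<in> carrier (G i) \<and> A = dlim_map G f i x)" for A
    by (auto simp: direct_limit_def quotient_def dlim_map_def)
  have o: "\<one>\<^bsub>?D\<^esub> = dlim_map G f k \<one>\<^bsub>G k\<^esub>" for k
  proof -
    have "transition f 0 k \<one>\<^bsub>G 0\<^esub> = \<one>\<^bsub>G k\<^esub>" using hom_one[OF th[of 0 k] g g] by simp
    then show ?thesis
      using dlim_map_eq_iff[of "\<one>\<^bsub>G 0\<^esub>" G 0 "\<one>\<^bsub>G k\<^esub>" k f] id[of k "\<one>\<^bsub>G k\<^esub>"]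
        monoid.one_closed[OF group.is_monoid[OF g[of 0]]] monoid.one_closed[OF group.is_monoid[OF g[of k]]]
      unfolding direct_limit_def by (simp, metis order_refl zero_le)
  qed
  have shift: "dlim_map G f i x = dlim_map G f k (transition f i k x)" if "i \<le> k" "x \<in> carrier (G i)" for i k x
    using that tc by (subst dlim_map_eq_iff) (auto intro!: exI[of _ k] simp: id)
  have m: "dlim_map G f k x \<otimes>\<^bsub>?D\<^esub> dlim_map G f k y = dlim_map G f k (x \<otimes>\<^bsub>G k\<^esub> y)"
    if "x \<in> carrier (G k)" "y \<in> carrier (G k)" for k x y
    using mult[OF that, of k] by (simp add: id)
  have common: "\<exists>k u v w. u \<in> carrier (G k) \<and> v \<in> carrier (G k) \<and> w \<in> carrier (G k) \<and>
      A = dlim_map G f k u \<and> B = dlim_map G f k v \<and> C = dlim_map G f k w"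
    if ABC: "A \<in> carrier ?D" "B \<in> carrier ?D" "C \<in> carrier ?D" for A B C
  proof -
    obtain i x j y l z where *: "x \<in> carrier (G i)" "A = dlim_map G f i x" "y \<in> carrier (G j)" "B = dlim_map G f j y"
      "z \<in> carrier (G l)" "C = dlim_map G f l z" using ABC unfolding c by blast
    define k where "k = max i (max j l)"
    have "i \<le> k" "j \<le> k" "l \<le> k" by (auto simp: k_def)
    then show ?thesis
      using * tc[OF \<open>i \<le> k\<close>, of x] tc[OF \<open>j \<le> k\<close>, of y] tc[OF \<open>l \<le> k\<close>, of z]
        shift[OF \<open>i \<le> k\<close>, of x] shift[OF \<open>j \<le> k\<close>, of y] shift[OF \<open>l \<le> k\<close>, of z]
      by (intro exI[of _ k] exI[of _ "transition f i k x"] exI[of _ "transition f j k y"] exI[of _ "transition f l k z"]) auto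
  qed
  show ?thesis
  proof (rule groupI)
    fix A B assume "A \<in> carrier ?D" "B \<in> carrier ?D"
    then obtain k u v where "u \<in> carrier (G k)" "v \<in> carrier (G k)" "A = dlim_map G f k u" "B = dlim_map G f k v"
      using common[of A B B] by blast
    moreover from this have "u \<otimes>\<^bsub>G k\<^esub> v \<in> carrier (G k)"
      using g[of k] by (simp add: group.is_monoid monoid.m_closed)
    ultimately show "A \<otimes>\<^bsub>?D\<^esub> B \<in> carrier ?D" unfolding c by (auto simp: m)
  next
    show "\<one>\<^bsub>?D\<^esub> \<in> carrier ?D" unfolding c o[of 0] using monoid.one_closed[OF group.is_monoid[OF g[of 0]]] by blast
  next
    fix A B C assume "A \<in> carrier ?D" "B \<in> carrier ?D" "C \<in> carrier ?D"
    then obtain k u v w where "u \<in> carrier (G k)" "v \<in> carrier (G k)" "w \<in> carrier (G k)"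
      "A = dlim_map G f k u" "B = dlim_map G f k v" "C = dlim_map G f k w"
      using common[of A B C] by blast
    moreover have "monoid (G k)" using g group.is_monoid by blast
    ultimately show "A \<otimes>\<^bsub>?D\<^esub> B \<otimes>\<^bsub>?D\<^esub> C = A \<otimes>\<^bsub>?D\<^esub> (B \<otimes>\<^bsub>?D\<^esub> C)"
      by (simp add: m monoid.m_closed monoid.m_assoc)
  next
    fix A assume "A \<in> carrier ?D"
    then obtain k u where u: "u \<in> carrier (G k)" "A = dlim_map G f k u" unfolding c by blast
    interpret group "G k" by (rule g)
    show "\<one>\<^bsub>?D\<^esub> \<otimes>\<^bsub>?D\<^esub> A = A" using u by (simp add: o[of k] m)
    show "\<exists>B\<in>carrier ?D. B \<otimes>\<^bsub>?D\<^esub> A = \<one>\<^bsub>?D\<^esub>"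
    proof
      show "dlim_map G f k (inv\<^bsub>G k\<^esub> u) \<otimes>\<^bsub>?D\<^esub> A = \<one>\<^bsub>?D\<^esub>" using u by (simp add: o[of k] m)
      show "dlim_map G f k (inv\<^bsub>G k\<^esub> u) \<in> carrier ?D" unfolding c using u by blast
    qed
  qed
qed

subsection \<open>Asymptotic cones\<close>

lemma ultra_lim:
  fixes f :: "nat \<Rightarrow> real"
  assumes w: "nonprincipal_ultrafilter \<omega>" and b: "eventually (\<lambda>n. f n \<in> {a..b}) \<omega>"
  shows "\<exists>l. (f \<longlongrightarrow> l) \<omega>"
proof -
  have nb: "filtermap f \<omega> \<noteq> bot" using w by (simp add: nonprincipal_ultrafilter_def filtermap_bot_iff)
  have "eventually (\<lambda>x. x \<in> {a..b}) (filtermap f \<omega>)" using b by (simp add: eventually_filtermap)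
  then obtain x where x: "inf (nhds x) (filtermap f \<omega>) \<noteq> bot"
    using compact_Icc[of a b] nb unfolding compact_filter by blast
  have "(f \<longlongrightarrow> x) \<omega>"
  proof (rule topological_tendstoI)
    fix S assume S: "open S" "x \<in> S"
    have "\<not> eventually (\<lambda>n. f n \<notin> S) \<omega>"
    proof
      assume "eventually (\<lambda>n. f n \<notin> S) \<omega>"
      then have "eventually (\<lambda>y. y \<notin> S) (filtermap f \<omega>)" by (simp add: eventually_filtermap)
      moreover have "eventually (\<lambda>y. y \<in> S) (nhds x)" using S by (rule eventually_nhds_in_open)
      ultimately have "eventually (\<lambda>_. False) (inf (nhds x) (filtermap f \<omega>))"
        unfolding eventually_inf by blast
      then show False using x by (simp add: trivial_limit_def)
    qed
    then show "eventually (\<lambda>n. f n \<in> S) \<omega>" using w by (auto simp: nonprincipal_ultrafilter_def)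
  qed
  then show ?thesis by blast
qed

lemma cone_metric:
  assumes d: "Metric_space M d" and e: "e \<in> M" and s: "\<And>n. s n > 0" and w: "nonprincipal_ultrafilter \<omega>"
  shows "Metric_space (asymptotic_cone M d e s \<omega>) (cone_dist M d e s \<omega>)"
proof -
  interpret D: Metric_space M d by fact
  let ?Q = "cone_seqs M d e s \<omega>" and ?R = "cone_rel M d e s \<omega>" and ?K = "asymptotic_cone M d e s \<omega>"
  define L where "L x y = Lim \<omega> (\<lambda>n. d (x n) (y n) / s n)" for x y
  have nb: "\<omega> \<noteq> bot" using w by (simp add: nonprincipal_ultrafilter_def)
  have mem: "x n \<in> M" if "x \<in> ?Q" for x n using that by (auto simp: cone_seqs_def)
  have L: "((\<lambda>n. d (x n) (y n) / s n) \<longlongrightarrow> L x y) \<omega>" if "x \<in> ?Q" "y \<in> ?Q" for x y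
  proof -
    obtain C where C: "eventually (\<lambda>n. d e (x n) / s n \<le> C) \<omega>" using \<open>x \<in> ?Q\<close> by (auto simp: cone_seqs_def)
    obtain C' where C': "eventually (\<lambda>n. d e (y n) / s n \<le> C') \<omega>" using \<open>y \<in> ?Q\<close> by (auto simp: cone_seqs_def)
    have "eventually (\<lambda>n. d (x n) (y n) / s n \<in> {0..C + C'}) \<omega>"
      using C C'
    proof eventually_elim
      case (elim n)
      have "d (x n) (y n) \<le> d e (x n) + d e (y n)"
        using D.triangle[of "x n" e "y n"] mem that e D.commute[of e "x n"] by auto
      then have "d (x n) (y n) / s n \<le> d e (x n) / s n + d e (y n) / s n"
        using s[of n] by (simp add: add_divide_distrib[symmetric] divide_right_mono)
      then show ?case using elim s[of n] by (auto simp: less_imp_le)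
    qed
    from ultra_lim[OF w this] obtain l where l: "((\<lambda>n. d (x n) (y n) / s n) \<longlongrightarrow> l) \<omega>" by blast
    then show ?thesis using tendsto_Lim[OF nb l] by (simp add: L_def)
  qed
  have Lu: "L x y = l" if "((\<lambda>n. d (x n) (y n) / s n) \<longlongrightarrow> l) \<omega>" for x y l
    using tendsto_Lim[OF nb that] by (simp add: L_def)
  have Lnn: "0 \<le> L x y" if "x \<in> ?Q" "y \<in> ?Q" for x y
    by (rule tendsto_lowerbound[OF L[OF that] _ nb]) (use s in \<open>auto simp: less_imp_le\<close>)
  have Ltri: "L x z \<le> L x y + L y z" if "x \<in> ?Q" "y \<in> ?Q" "z \<in> ?Q" for x y z
  proof (rule tendsto_le[OF nb tendsto_add[OF L[OF that(1,2)] L[OF that(2,3)]] L[OF that(1,3)]])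
    show "eventually (\<lambda>n. d (x n) (z n) / s n \<le> d (x n) (y n) / s n + d (y n) (z n) / s n) \<omega>"
      by (intro always_eventually allI, unfold add_divide_distrib[symmetric], intro divide_right_mono D.triangle mem that less_imp_le[OF s])
  qed
  have Lsym: "L x y = L y x" for x y unfolding L_def by (simp add: D.commute)
  have Lrefl: "L x x = 0" if "x \<in> ?Q" for x
    by (rule Lu) (use mem[OF that] in simp)
  have R: "(x, y) \<in> ?R \<longleftrightarrow> x \<in> ?Q \<and> y \<in> ?Q \<and> L x y = 0" for x y
    using L[of x y] Lu[of x y 0] by (auto simp: cone_rel_def)
  have eqv: "equiv ?Q ?R"
  proof (rule equivI)
    show "?R \<subseteq> ?Q \<times> ?Q" using R by auto
    show "refl_on ?Q ?R" using R Lrefl by (auto simp: refl_on_def)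
    show "sym ?R" using R Lsym by (auto simp: sym_def)
    show "trans ?R"
    proof (rule transI)
      fix x y z assume "(x, y) \<in> ?R" "(y, z) \<in> ?R"
      then show "(x, z) \<in> ?R" using Ltri[of x y z] Lnn[of x z] unfolding R by auto
    qed
  qed
  have cd: "cone_dist M d e s \<omega> (?R `` {x}) (?R `` {y}) = L x y" if "x \<in> ?Q" "y \<in> ?Q" for x y
  proof -
    have "L x' y' = L x y" if "(x, x') \<in> ?R" "(y, y') \<in> ?R" for x' y'
    proof -
      have q: "x \<in> ?Q" "x' \<in> ?Q" "L x x' = 0" "y \<in> ?Q" "y' \<in> ?Q" "L y y' = 0" using that R by auto
      have "L x' y' \<le> L x y" using Ltri[of x' x y'] Ltri[of x y y'] Lsym[of x' x] q by auto
      moreover have "L x y \<le> L x' y'" using Ltri[of x x' y] Ltri[of x' y' y] Lsym[of y' y] q by auto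
      ultimately show ?thesis by simp
    qed
    note const = this
    have xy: "x \<in> ?R `` {x}" "y \<in> ?R `` {y}" using that R Lrefl by auto
    have "(\<lambda>(x, y). L x y) ` (?R `` {x} \<times> ?R `` {y}) = {L x y}"
    proof
      show "(\<lambda>(x, y). L x y) ` (?R `` {x} \<times> ?R `` {y}) \<subseteq> {L x y}" using const by auto
      have "L x y \<in> (\<lambda>(x, y). L x y) ` (?R `` {x} \<times> ?R `` {y})"
        by (rule image_eqI[of _ _ "(x, y)"]) (use xy in auto)
      then show "{L x y} \<subseteq> (\<lambda>(x, y). L x y) ` (?R `` {x} \<times> ?R `` {y})" by blast
    qed
    moreover have "?R `` {x} \<in> ?K" "?R `` {y} \<in> ?K" using that by (auto simp: asymptotic_cone_def quotientI)
    ultimately show ?thesis by (simp add: cone_dist_def L_def)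
  qed
  have rep: "\<exists>x\<in>?Q. A = ?R `` {x}" if "A \<in> ?K" for A
    using that by (auto simp: asymptotic_cone_def elim!: quotientE)
  have off: "cone_dist M d e s \<omega> A B = 0" if "\<not> (A \<in> ?K \<and> B \<in> ?K)" for A B
    using that unfolding cone_dist_def by (subst if_not_P) auto
  show ?thesis
  proof
    fix A B
    show "0 \<le> cone_dist M d e s \<omega> A B" 
    proof (cases "A \<in> ?K \<and> B \<in> ?K")
      case True
      then obtain x y where "x \<in> ?Q" "y \<in> ?Q" "A = ?R `` {x}" "B = ?R `` {y}" using rep by meson
      then show ?thesis using cd[of x y] Lnn[of x y] by simp
    qed (simp add: off)
    show "cone_dist M d e s \<omega> A B = cone_dist M d e s \<omega> B A"
    proof (cases "A \<in> ?K \<and> B \<in> ?K")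
      case True
      then obtain x y where "x \<in> ?Q" "y \<in> ?Q" "A = ?R `` {x}" "B = ?R `` {y}" using rep by meson
      then show ?thesis using cd[of x y] cd[of y x] Lsym[of x y] by simp
    next
      case False
      then show ?thesis using off[of A B] off[of B A] by auto
    qed
  next
    fix A B assume "A \<in> ?K" "B \<in> ?K"
    then obtain x y where "x \<in> ?Q" "y \<in> ?Q" "A = ?R `` {x}" "B = ?R `` {y}" using rep by meson
    then show "(cone_dist M d e s \<omega> A B = 0) = (A = B)"
      using cd[of x y] eq_equiv_class_iff[OF eqv, of x y] R[of x y] by simp
  next
    fix A B C assume "A \<in> ?K" "B \<in> ?K" "C \<in> ?K"
    then obtain x y z where "x \<in> ?Q" "y \<in> ?Q" "z \<in> ?Q" "A = ?R `` {x}" "B = ?R `` {y}" "C = ?R `` {z}" using rep by meson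
    then show "cone_dist M d e s \<omega> A C \<le> cone_dist M d e s \<omega> A B + cone_dist M d e s \<omega> B C"
      using cd Ltri[of x y z] by simp
  qed
qed

end

theory Submission
  imports Defs
begin

text \<open>Write \<open>\<Lambda>\<close> for the limit group. Both conclusions come from short arguments about \<open>\<Lambda>\<close> itself.

  Mixed identity freeness. That a mixed word \<open>w\<close> is an identity of \<open>\<Lambda>\<close> is expressed by the universal
  sentence \<open>\<forall>x. w(x) = 1\<close> with parameters in \<open>\<Lambda>\<close>, so by the elementary embedding \<open>w\<close> also vanishes
  under every substitution in \<open>\<Lambda> * \<int>\<close> (\<open>mixed_identity_transfers\<close>). But one substitution in
  \<open>\<Lambda> * \<int>\<close> already separates all elements of \<open>\<Lambda> * F\<^sub>n\<close>: if \<open>t\<close> generates \<open>\<int>\<close> and \<open>a \<noteq> 1\<close> lies in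
  \<open>\<Lambda>\<close>, send the \<open>i\<close>-th basis element to \<open>t\<^sup>k a t\<^sup>k\<close> with \<open>k = i + 1\<close>. In the image of a
  reduced mixed word the letters \<open>a\<close> and \<open>a\<^sup>-\<^sup>1\<close> contributed by the basis elements survive, because two
  powers of \<open>t\<close> that meet have exponents with nonzero sum unless a basis element stands next to its own
  inverse (\<open>separating_image_normal_form\<close>). To see that such an image is nontrivial in the free
  product, which is given by generators and relations, the free product is made to act on reduced
  words (\<open>foldr_push_cong\<close>).

  No 2-transitive action. Suppose that \<open>\<Lambda>\<close> acts 2-transitively. Point stabilizers are proper
  subgroups, hence cyclic, hence abelian, and the stabilizer of \<open>x\<close> is transitive on the other points.
  Let \<open>g\<close> swap \<open>x\<close> and \<open>y\<close>. Then \<open>g\<^sup>2\<close> lies in the stabilizer of \<open>x\<close> and fixes \<open>y\<close>; since it commutes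
  with a group that moves \<open>y\<close> to every other point, it fixes everything. The action is faithful by
  simplicity, so \<open>g\<^sup>2 = 1\<close>, which contradicts torsion-freeness
  (\<open>no_two_transitive_action\<close>).\<close>

section \<open>Normal forms in free products\<close>

lemma not_successivelyE:
  assumes "\<not> successively P xs"
  obtains us x y vs where "xs = us @ [x, y] @ vs" "\<not> P x y"
proof -
  have "\<exists>us x y vs. xs = us @ [x, y] @ vs \<and> \<not> P x y"
    using assms
  proof (induction P xs rule: successively.induct)
    case (3 P x y xs)
    show ?case
    proof (cases "P x y")
      case True
      then have "\<not> successively P (y # xs)" using 3(2) by simp
      then obtain us x' y' vs where "y # xs = us @ [x', y'] @ vs" "\<not> P x' y'" using 3(1) True by blast
      then have "x # y # xs = (x # us) @ [x', y'] @ vs" by simp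
      then show ?thesis using \<open>\<not> P x' y'\<close> by blast
    next
      case False
      have "x # y # xs = [] @ [x, y] @ xs" by simp
      then show ?thesis using False by blast
    qed
  qed auto
  then show thesis using that by blast
qed

locale group_pair = G: group G + H: group H
  for G :: "('a, 'm) monoid_scheme" and H :: "('b, 'n) monoid_scheme"
begin

abbreviation letters :: "('a + 'b) set" where
  "letters \<equiv> Inl ` carrier G \<union> Inr ` carrier H"

abbreviation cong :: "('a + 'b) list \<Rightarrow> ('a + 'b) list \<Rightarrow> bool" where
  "cong \<equiv> word_cong letters (free_product_rels G H)"

abbreviation cls :: "('a + 'b) list \<Rightarrow> ('a + 'b) list set" where
  "cls \<equiv> word_class letters (free_product_rels G H)"

definition trivial_letter :: "'a + 'b \<Rightarrow> bool" where
  "trivial_letter l = (case l of Inl x \<Rightarrow> x = \<one>\<^bsub>G\<^esub> | Inr y \<Rightarrow> y = \<one>\<^bsub>H\<^esub>)"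

text \<open>The product is only meaningful for two letters from the same factor.\<close>

definition letter_mult :: "'a + 'b \<Rightarrow> 'a + 'b \<Rightarrow> 'a + 'b" where
  "letter_mult l m = (case l of
      Inl x \<Rightarrow> (case m of Inl y \<Rightarrow> Inl (x \<otimes>\<^bsub>G\<^esub> y) | Inr _ \<Rightarrow> l)
    | Inr x \<Rightarrow> (case m of Inl _ \<Rightarrow> l | Inr y \<Rightarrow> Inr (x \<otimes>\<^bsub>H\<^esub> y)))"

definition reduced :: "('a + 'b) list \<Rightarrow> bool" where
  "reduced r \<longleftrightarrow> r \<in> lists letters \<and> (\<forall>l\<in>set r. \<not> trivial_letter l) \<and>
     successively (\<lambda>l m. isl l \<noteq> isl m) r"

text \<open>Left multiplication by a letter, carried out on normal forms.\<close>

definition push :: "'a + 'b \<Rightarrow> ('a + 'b) list \<Rightarrow> ('a + 'b) list" where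
  "push l r =
     (if trivial_letter l then r
      else case r of
        [] \<Rightarrow> [l]
      | m # r' \<Rightarrow>
          if isl l = isl m
          then if trivial_letter (letter_mult l m) then r' else letter_mult l m # r'
          else l # r)"

lemma letter_mult_simps [simp]:
  "letter_mult (Inl x) (Inl y) = Inl (x \<otimes>\<^bsub>G\<^esub> y)"
  "letter_mult (Inr z) (Inr t) = Inr (z \<otimes>\<^bsub>H\<^esub> t)"
  by (auto simp: letter_mult_def)

lemma trivial_letter_simps [simp]:
  "trivial_letter (Inl x) \<longleftrightarrow> x = \<one>\<^bsub>G\<^esub>"
  "trivial_letter (Inr y) \<longleftrightarrow> y = \<one>\<^bsub>H\<^esub>"
  by (auto simp: trivial_letter_def)

lemma letter_mult_closed:
  assumes "l \<in> letters" "m \<in> letters" "isl l = isl m"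
  shows "letter_mult l m \<in> letters" "isl (letter_mult l m) = isl m"
  using assms by auto

lemma letter_mult_assoc:
  assumes "l \<in> letters" "m \<in> letters" "k \<in> letters" "isl l = isl m" "isl m = isl k"
  shows "letter_mult (letter_mult l m) k = letter_mult l (letter_mult m k)"
  using assms by (auto simp: G.m_assoc H.m_assoc)

lemma letter_mult_trivial:
  assumes "l \<in> letters" "m \<in> letters" "isl l = isl m"
  shows "trivial_letter l \<Longrightarrow> letter_mult l m = m" "trivial_letter m \<Longrightarrow> letter_mult l m = l"
  using assms by auto

lemma rels_lists: "free_product_rels G H \<subseteq> lists letters \<times> lists letters"
  by (rule free_product_rels_lists) unfold_locales

lemma cong_mult:
  assumes "l \<in> letters" "m \<in> letters" "isl l = isl m" "u \<in> lists letters" "v \<in> lists letters"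
  shows "cong (u @ [l, m] @ v) (u @ [letter_mult l m] @ v)"
  by (rule word_cong.base) (use assms in \<open>auto simp: free_product_rels_def\<close>)

lemma cong_trivial:
  assumes "l \<in> letters" "trivial_letter l" "u \<in> lists letters" "v \<in> lists letters"
  shows "cong (u @ [l] @ v) (u @ v)"
proof -
  have "cong (u @ [l] @ v) (u @ [] @ v)"
    by (rule word_cong.base) (use assms in \<open>auto simp: free_product_rels_def\<close>)
  then show ?thesis by simp
qed

lemma cong_cancel:
  assumes "l \<in> letters" "m \<in> letters" "isl l = isl m" "trivial_letter (letter_mult l m)"
    "u \<in> lists letters" "v \<in> lists letters"
  shows "cong (u @ [l, m] @ v) (u @ v)"
  using cong_mult[of l m u v] cong_trivial[of "letter_mult l m" u v] letter_mult_closed[of l m] assms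
  by (meson word_cong.trans)

lemma reduced_Cons:
  "reduced (l # r) \<longleftrightarrow> l \<in> letters \<and> \<not> trivial_letter l \<and> reduced r \<and>
     (r = [] \<or> isl l \<noteq> isl (hd r))"
  by (cases r) (auto simp: reduced_def)

lemma push_reduced:
  assumes l: "l \<in> letters" and r: "reduced r"
  shows "reduced (push l r)"
proof (cases r)
  case Nil
  then show ?thesis using assms by (simp add: push_def reduced_Cons)
next
  case (Cons m r')
  then show ?thesis
    using assms letter_mult_closed[of l m] by (auto simp: push_def reduced_Cons)
qed

text \<open>Multiplying by two letters of one factor in turn is multiplying by their product. The one
  delicate case is a head that is cancelled by the first letter: then the second letter meets
  a word that starts in the other factor, because the word was reduced.\<close>

lemma push_mult:
  assumes l: "l \<in> letters" and m: "m \<in> letters" and s: "isl l = isl m" and r: "reduced r"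
  shows "push l (push m r) = push (letter_mult l m) r"
proof (cases "trivial_letter l \<or> trivial_letter m")
  case True
  then show ?thesis
  proof
    assume "trivial_letter l"
    then show ?thesis using letter_mult_trivial(1)[OF l m s] by (simp add: push_def[of l])
  next
    assume "trivial_letter m"
    then show ?thesis using letter_mult_trivial(2)[OF l m s] by (simp add: push_def[of m])
  qed
next
  case nt: False
  have lm: "letter_mult l m \<in> letters" "isl (letter_mult l m) = isl m"
    using letter_mult_closed[OF l m s] by auto
  show ?thesis
  proof (cases "r \<noteq> [] \<and> isl (hd r) = isl m")
    case False
    then show ?thesis using nt s lm by (cases r) (simp_all add: push_def)
  next
    case True
    then obtain k r' where k: "r = k # r'" "isl k = isl m" by (cases r) auto
    have kl: "k \<in> letters" and kn: "\<not> trivial_letter k"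
      and r': "r' = [] \<or> isl k \<noteq> isl (hd r')"
      using r k by (auto simp: reduced_Cons)
    have mk: "letter_mult m k \<in> letters" "isl (letter_mult m k) = isl m"
      using letter_mult_closed[OF m kl] k by auto
    have as: "letter_mult (letter_mult l m) k = letter_mult l (letter_mult m k)"
      using letter_mult_assoc[OF l m kl s] k by simp
    have A: "trivial_letter (letter_mult l m) \<Longrightarrow> letter_mult l (letter_mult m k) = k"
      using letter_mult_trivial(1)[OF lm(1) kl] lm(2) k as by simp
    have B: "trivial_letter (letter_mult m k) \<Longrightarrow> letter_mult l (letter_mult m k) = l"
      using letter_mult_trivial(2)[OF l mk(1)] mk(2) s by simp
    show ?thesis
    proof (cases "trivial_letter (letter_mult m k)")
      case T: True
      have "push l (push m r) = l # r'"
        using T nt k s r' by (auto simp: push_def split: list.split)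
      moreover have "push (letter_mult l m) r = l # r'"
        using A B T nt k lm as by (auto simp: push_def)
      ultimately show ?thesis by simp
    next
      case F: False
      then show ?thesis using A nt k s kn lm mk as by (auto simp: push_def)
    qed
  qed
qed

lemma foldr_push_reduced:
  assumes "w \<in> lists letters" "reduced r"
  shows "reduced (foldr push w r)"
  using assms
proof (induction w)
  case (Cons l w)
  then have "l \<in> letters" "w \<in> lists letters" by blast+
  then show ?case using Cons push_reduced[of l "foldr push w r"] by simp
qed simp

text \<open>This is van der Waerden's trick: by \<open>push_mult\<close> the letters act on reduced words in a way that
  respects the defining relations, so the word obtained from the empty word is an invariant of the
  element of the free product.\<close>

lemma foldr_push_cong:
  assumes "cong v w" "reduced r"
  shows "foldr push v r = foldr push w r"
  using assms
proof induction
  case (base l m u v)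
  have red: "reduced (foldr push v r)" using base foldr_push_reduced by blast
  have "foldr push l (foldr push v r) = foldr push m (foldr push v r)"
    using base(1) push_mult[OF _ _ _ red] by (auto simp: free_product_rels_def) (auto simp: push_def)
  then show ?case by simp
qed auto

lemma cls_neq_one:
  assumes "w \<in> lists letters" "foldr push w [] \<noteq> []"
  shows "cls w \<noteq> \<one>\<^bsub>free_product G H\<^esub>"
proof
  assume "cls w = \<one>\<^bsub>free_product G H\<^esub>"
  then have "cong w []"
    using word_class_eq_iff[of "[]" letters "free_product_rels G H" w]
    by (simp add: free_product_def presented_monoid_def)
  then have "foldr push w [] = foldr push [] []"
    by (rule foldr_push_cong) (simp add: reduced_def)
  then show False using assms(2) by simp
qed

lemma cls_mult:
  assumes "v \<in> lists letters" "w \<in> lists letters"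
  shows "cls v \<otimes>\<^bsub>free_product G H\<^esub> cls w = cls (v @ w)"
  unfolding free_product_def by (rule presented_mult[OF rels_lists assms])

lemma cls_closed: "w \<in> lists letters \<Longrightarrow> cls w \<in> carrier (free_product G H)"
  by (simp add: free_product_def presented_monoid_def)

lemma cls_Nil: "cls [] = \<one>\<^bsub>free_product G H\<^esub>"
  by (simp add: free_product_def presented_monoid_def)

lemma cls_eqI:
  assumes "cong v w"
  shows "cls v = cls w"
  using word_class_eq_iff[of w letters "free_product_rels G H" v]
    word_cong_lists[OF assms rels_lists] assms by simp

lemma word_eval_cls:
  assumes "\<And>l. l \<in> set u \<Longrightarrow> \<sigma> l \<in> lists letters"
  shows "word_eval (free_product G H) (\<lambda>l. cls (\<sigma> l)) u = cls (concat (map \<sigma> u))"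
  using assms
proof (induction u)
  case Nil
  then show ?case by (simp add: word_eval_def cls_Nil)
next
  case (Cons l u)
  have "concat (map \<sigma> u) \<in> lists letters" using Cons.prems by fastforce
  then show ?case using Cons cls_mult[of "\<sigma> l"] by (simp add: word_eval_def)
qed

end

section \<open>Mixed words\<close>

definition literal :: "('k, 'm) monoid_scheme \<Rightarrow> ('x \<Rightarrow> 'k) \<Rightarrow> 'x \<times> bool \<Rightarrow> 'k" where
  "literal K \<xi> = (\<lambda>(x, b). if b then \<xi> x else inv\<^bsub>K\<^esub> (\<xi> x))"

text \<open>Elements of \<open>G * F(X)\<close> are handled through words in the elements of \<open>G\<close> and the letters of the
  free group, instead of the words of the free product, whose entries from the second factor are
  themselves classes of words.\<close>

definition mixed_words :: "('a, 'm) monoid_scheme \<Rightarrow> 'x set \<Rightarrow> ('a + 'x \<times> bool) list set" where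
  "mixed_words G X = lists (Inl ` carrier G \<union> Inr ` (X \<times> UNIV))"

definition mixed_letter :: "'x set \<Rightarrow> 'a + 'x \<times> bool \<Rightarrow> 'a + ('x \<times> bool) list set" where
  "mixed_letter X = map_sum id (\<lambda>l. word_class (X \<times> UNIV) (free_group_rels X) [l])"

definition mixed_class ::
  "('a, 'm) monoid_scheme \<Rightarrow> 'x set \<Rightarrow> ('a + 'x \<times> bool) list \<Rightarrow> ('a + ('x \<times> bool) list set) list set" where
  "mixed_class G X u =
     word_class (Inl ` carrier G \<union> Inr ` carrier (free_group X)) (free_product_rels G (free_group X))
       (map (mixed_letter X) u)"

fun irreducible_pair :: "'a + 'x \<times> bool \<Rightarrow> 'a + 'x \<times> bool \<Rightarrow> bool" where
  "irreducible_pair (Inl g) (Inl h) = False"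
| "irreducible_pair (Inr (x, b)) (Inr (y, c)) = (x = y \<longrightarrow> b = c)"
| "irreducible_pair _ _ = True"

definition reduced_mixed_word :: "('a, 'm) monoid_scheme \<Rightarrow> ('a + 'x \<times> bool) list \<Rightarrow> bool" where
  "reduced_mixed_word G u \<longleftrightarrow> Inl \<one>\<^bsub>G\<^esub> \<notin> set u \<and> successively irreducible_pair u"

lemma free_group_rels_lists: "free_group_rels X \<subseteq> lists (X \<times> UNIV) \<times> lists (X \<times> UNIV)"
  by (auto simp: free_group_rels_def)

lemma mixed_letter_closed:
  assumes "l \<in> Inl ` carrier G \<union> Inr ` (X \<times> UNIV)"
  shows "mixed_letter X l \<in> Inl ` carrier G \<union> Inr ` carrier (free_group X)"
  using assms by (auto simp: mixed_letter_def free_group_def presented_monoid_def)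

lemma map_mixed_letter_closed:
  assumes "u \<in> mixed_words G X"
  shows "map (mixed_letter X) u \<in> lists (Inl ` carrier G \<union> Inr ` carrier (free_group X))"
  using assms mixed_letter_closed[of _ G X] unfolding mixed_words_def by fastforce

lemma mixed_class_surj:
  assumes G: "group G" and w: "w \<in> carrier (free_product G (free_group X))"
  shows "\<exists>u\<in>mixed_words G X. w = mixed_class G X u"
proof -
  interpret group_pair G "free_group X"
    using G free_group_group by (simp add: group_pair_def)
  let ?F = "free_group X" and ?B = "X \<times> (UNIV :: bool set)"
  let ?c = "word_class ?B (free_group_rels X)"
  have free: "\<exists>u\<in>mixed_words G X. cong [Inr (?c ls)] (map (mixed_letter X) u)"
    if "ls \<in> lists ?B" for ls
    using that
  proof (induction ls)
    case Nil
    have "?c [] = \<one>\<^bsub>?F\<^esub>" by (simp add: free_group_def presented_monoid_def)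
    then have "trivial_letter (Inr (?c []))" by simp
    moreover have "?c [] \<in> carrier ?F" by (simp add: free_group_def presented_monoid_def)
    ultimately have "cong [Inr (?c [])] []"
      using cong_trivial[of "Inr (?c [])" "[]" "[]"] by simp
    then show ?case by (intro bexI[of _ "[]"]) (auto simp: mixed_words_def)
  next
    case (Cons l ls)
    then have l: "l \<in> ?B" and ls: "ls \<in> lists ?B" by blast+
    obtain u where u: "u \<in> mixed_words G X" "cong [Inr (?c ls)] (map (mixed_letter X) u)"
      using Cons.IH ls by blast
    have cl: "?c [l] \<in> carrier ?F" "?c ls \<in> carrier ?F"
      using l ls by (auto simp: free_group_def presented_monoid_def)
    have "?c (l # ls) = ?c [l] \<otimes>\<^bsub>?F\<^esub> ?c ls"
      unfolding free_group_def
      using presented_mult[OF free_group_rels_lists, of "[l]" X ls] l ls by simp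
    then have "cong [Inr (?c [l]), Inr (?c ls)] [Inr (?c (l # ls))]"
      using cong_mult[of "Inr (?c [l])" "Inr (?c ls)" "[]" "[]"] cl by simp
    moreover have "cong ([Inr (?c [l])] @ [Inr (?c ls)] @ []) ([Inr (?c [l])] @ map (mixed_letter X) u @ [])"
      using u(2) cl by (intro word_cong_append) auto
    ultimately have "cong [Inr (?c (l # ls))] (map (mixed_letter X) (Inr l # u))"
      by (auto simp: mixed_letter_def intro: word_cong.sym word_cong.trans)
    moreover have "Inr l # u \<in> mixed_words G X" using u(1) l by (auto simp: mixed_words_def)
    ultimately show ?case by blast
  qed
  have letter: "\<exists>u\<in>mixed_words G X. cong [l] (map (mixed_letter X) u)" if "l \<in> letters" for l
  proof (cases l)
    case (Inl g)
    with that show ?thesis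
      by (intro bexI[of _ "[Inl g]"]) (auto simp: mixed_letter_def mixed_words_def intro: word_cong.refl)
  next
    case (Inr W)
    with that obtain ls where "ls \<in> lists ?B" "W = ?c ls"
      by (auto simp: free_group_def presented_monoid_def)
    then show ?thesis using free Inr by blast
  qed
  have "\<exists>u\<in>mixed_words G X. cong v (map (mixed_letter X) u)" if "v \<in> lists letters" for v
    using that
  proof (induction v)
    case Nil
    then show ?case by (intro bexI[of _ "[]"]) (auto simp: mixed_words_def intro: word_cong.refl)
  next
    case (Cons l v)
    then have l: "l \<in> letters" and v: "v \<in> lists letters" by blast+
    obtain u where u: "u \<in> mixed_words G X" "cong v (map (mixed_letter X) u)"
      using Cons.IH v by blast
    obtain u' where u': "u' \<in> mixed_words G X" "cong [l] (map (mixed_letter X) u')"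
      using letter l by blast
    have "cong (l # v) (map (mixed_letter X) (u' @ u))"
      using word_cong_append2[OF u'(2) u(2) rels_lists] by simp
    moreover have "u' @ u \<in> mixed_words G X" using u u' by (auto simp: mixed_words_def)
    ultimately show ?case by blast
  qed
  moreover obtain v where "v \<in> lists letters" "w = cls v"
    using w by (auto simp: free_product_def presented_monoid_def)
  ultimately obtain u where "u \<in> mixed_words G X" "w = cls v" "cong v (map (mixed_letter X) u)"
    by blast
  then show ?thesis using cls_eqI unfolding mixed_class_def by blast
qed

text \<open>A representative of minimal length is reduced, as any reduction would shorten it.\<close>

lemma reduced_mixed_word_exists:
  assumes G: "group G" and w: "w \<in> carrier (free_product G (free_group X))"
  shows "\<exists>u\<in>mixed_words G X. reduced_mixed_word G u \<and> w = mixed_class G X u"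
proof -
  interpret group_pair G "free_group X"
    using G free_group_group by (simp add: group_pair_def)
  let ?P = "\<lambda>u. u \<in> mixed_words G X \<and> w = mixed_class G X u"
  let ?L = "Inl ` carrier G \<union> Inr ` (X \<times> (UNIV :: bool set))"
  obtain u where u: "?P u" and min: "\<And>u'. ?P u' \<Longrightarrow> length u \<le> length u'"
    using mixed_class_surj[OF G w] exists_least_iff[of "\<lambda>n. \<exists>u. ?P u \<and> length u = n"]
    by (metis not_le)
  have no: "\<not> cong (map (mixed_letter X) u) (map (mixed_letter X) u')"
    if "u' \<in> mixed_words G X" "length u' < length u" for u'
    using min[of u'] that u cls_eqI unfolding mixed_class_def by (metis not_le)
  have "Inl \<one>\<^bsub>G\<^esub> \<notin> set u"
  proof
    assume "Inl \<one>\<^bsub>G\<^esub> \<in> set u"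
    then obtain p q where pq: "u = p @ Inl \<one>\<^bsub>G\<^esub> # q" by (meson split_list)
    then have mem: "p \<in> mixed_words G X" "q \<in> mixed_words G X" "p @ q \<in> mixed_words G X"
      using u by (auto simp: mixed_words_def)
    have "cong (map (mixed_letter X) u) (map (mixed_letter X) (p @ q))"
      using cong_trivial[OF _ _ mem(1,2)[THEN map_mixed_letter_closed], of "Inl \<one>\<^bsub>G\<^esub>"]
      by (simp add: pq mixed_letter_def)
    then show False using no[OF mem(3)] pq by simp
  qed
  moreover have "successively irreducible_pair u"
  proof (rule ccontr)
    assume "\<not> successively irreducible_pair u"
    then obtain p a b q where pq: "u = p @ [a, b] @ q" and ab: "\<not> irreducible_pair a b"
      by (rule not_successivelyE)
    then have mem: "p \<in> mixed_words G X" "q \<in> mixed_words G X" "p @ q \<in> mixed_words G X"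
      and abL: "a \<in> ?L" "b \<in> ?L"
      using u by (auto simp: mixed_words_def)
    note pqL = mem(1,2)[THEN map_mixed_letter_closed]
    from ab consider (const) g h where "a = Inl g" "b = Inl h"
      | (basis) x c where "a = Inr (x, c)" "b = Inr (x, \<not> c)"
      by (cases "(a, b)" rule: irreducible_pair.cases) auto
    then show False
    proof cases
      case const
      then have "cong (map (mixed_letter X) u) (map (mixed_letter X) (p @ [Inl (g \<otimes>\<^bsub>G\<^esub> h)] @ q))"
        using cong_mult[OF _ _ _ pqL, of "Inl g" "Inl h"] abL by (auto simp: pq mixed_letter_def)
      moreover have "p @ [Inl (g \<otimes>\<^bsub>G\<^esub> h)] @ q \<in> mixed_words G X"
        using mem const abL by (auto simp: mixed_words_def)
      ultimately show False using no pq by fastforce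
    next
      case basis
      let ?c = "word_class (X \<times> UNIV) (free_group_rels X)"
      have x: "x \<in> X" using abL basis by auto
      have "word_cong (X \<times> UNIV) (free_group_rels X) ([] @ [(x, c), (x, \<not> c)] @ []) ([] @ [] @ [])"
        using x by (intro word_cong.base) (auto simp: free_group_rels_def)
      then have "?c [(x, c), (x, \<not> c)] = ?c []"
        using word_class_eq_iff[of "[]" "X \<times> UNIV" "free_group_rels X" "[(x, c), (x, \<not> c)]"] by simp
      then have "?c [(x, c)] \<otimes>\<^bsub>free_group X\<^esub> ?c [(x, \<not> c)] = \<one>\<^bsub>free_group X\<^esub>"
        using presented_mult[OF free_group_rels_lists, of "[(x, c)]" X "[(x, \<not> c)]"] x
        by (simp add: free_group_def) (simp add: presented_monoid_def)
      then have "trivial_letter (letter_mult (mixed_letter X a) (mixed_letter X b))"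
        using basis by (simp add: mixed_letter_def)
      moreover have "isl (mixed_letter X a) = isl (mixed_letter X b)"
        using basis by (simp add: mixed_letter_def)
      ultimately have "cong (map (mixed_letter X) u) (map (mixed_letter X) (p @ q))"
        using cong_cancel[OF mixed_letter_closed[OF abL(1)] mixed_letter_closed[OF abL(2)] _ _ pqL]
        by (simp add: pq)
      then show False using no[OF mem(3)] pq by simp
    qed
  qed
  ultimately show ?thesis using u by (auto simp: reduced_mixed_word_def)
qed

lemma word_subst_mixed_class:
  assumes G: "group G" and u: "u \<in> mixed_words G {..<n}" and \<xi>: "\<xi> \<in> {..<n} \<rightarrow> carrier G"
  shows "word_subst G \<xi> (mixed_class G {..<n} u) = word_eval G (case_sum (\<lambda>g. g) (literal G \<xi>)) u"
proof -
  interpret group G by fact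
  let ?B = "{..<n} \<times> (UNIV :: bool set)"
  let ?c = "word_class ?B (free_group_rels {..<n})"
  have lift: "free_group_lift G \<xi> (?c ls) = word_eval G (literal G \<xi>) ls" if "ls \<in> lists ?B" for ls
    using free_group_lift_class[OF G \<xi> that] by (simp add: literal_def)
  have lit: "literal G \<xi> l \<in> carrier G" if "l \<in> ?B" for l
    using that \<xi> by (auto simp: literal_def Pi_iff)
  have "free_group_lift G \<xi> \<in> hom (free_group {..<n}) G"
  proof (rule homI)
    fix V W assume "V \<in> carrier (free_group {..<n})" "W \<in> carrier (free_group {..<n})"
    then obtain v w where v: "v \<in> lists ?B" "V = ?c v" and w: "w \<in> lists ?B" "W = ?c w"
      by (auto simp: free_group_def presented_monoid_def)
    have ev: "word_eval G (literal G \<xi>) v \<in> carrier G"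
      "word_eval G (literal G \<xi>) (v @ w) = word_eval G (literal G \<xi>) v \<otimes>\<^bsub>G\<^esub> word_eval G (literal G \<xi>) w"
      using word_eval_append[OF G lit v(1) w(1)] by auto
    show "free_group_lift G \<xi> V \<in> carrier G" using lift v ev(1) by simp
    have "V \<otimes>\<^bsub>free_group {..<n}\<^esub> W = ?c (v @ w)"
      unfolding free_group_def v(2) w(2) by (rule presented_mult[OF free_group_rels_lists v(1) w(1)])
    then show "free_group_lift G \<xi> (V \<otimes>\<^bsub>free_group {..<n}\<^esub> W) = free_group_lift G \<xi> V \<otimes>\<^bsub>G\<^esub> free_group_lift G \<xi> W"
      using lift[of "v @ w"] lift[of v] lift[of w] v w ev(2) by simp
  qed
  then have "word_subst G \<xi> (mixed_class G {..<n} u) =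
      word_eval G (case_sum (\<lambda>g. g) (free_group_lift G \<xi>)) (map (mixed_letter {..<n}) u)"
    unfolding word_subst_def mixed_class_def
    by (intro free_product_lift_class[OF G free_group_group G _ _ map_mixed_letter_closed[OF u]])
      (auto simp: hom_def)
  also have "\<dots> = word_eval G (case_sum (\<lambda>g. g) (literal G \<xi>)) u"
    using u unfolding mixed_words_def
  proof (induction u)
    case (Cons l u)
    then have l: "l \<in> Inl ` carrier G \<union> Inr ` ?B" by blast
    have "case_sum (\<lambda>g. g) (free_group_lift G \<xi>) (mixed_letter {..<n} l) =
        case_sum (\<lambda>g. g) (literal G \<xi>) l"
      using l lift[of "[projr l]"] lit[of "projr l"]
      by (auto simp: mixed_letter_def word_eval_def)
    then show ?case using Cons.IH by (simp add: word_eval_def)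
  qed (simp add: word_eval_def)
  finally show ?thesis .
qed

section \<open>Substituting into the free product with the integers\<close>

text \<open>The words \<open>t\<^sup>k a t\<^sup>k\<close> and their inverses, where the integer \<open>k\<close> stands for the \<open>k\<close>-th power of the
  generator \<open>t\<close>. The shift by one keeps \<open>k\<close> nonzero. Powers of \<open>t\<close> are put on both sides of \<open>a\<close> so that
  a constant next to a basis element stays separated from \<open>a\<close>, on either side.\<close>

definition separating_word :: "('a, 'm) monoid_scheme \<Rightarrow> 'a \<Rightarrow> nat \<times> bool \<Rightarrow> ('a + int) list" where
  "separating_word G a = (\<lambda>(i, b).
     (let k = (if b then int i + 1 else - (int i + 1)) in
       [Inr k, Inl (if b then a else inv\<^bsub>G\<^esub> a), Inr k]))"

definition separating_image :: "('a, 'm) monoid_scheme \<Rightarrow> 'a \<Rightarrow> ('a + nat \<times> bool) list \<Rightarrow> ('a + int) list" where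
  "separating_image G a u = concat (map (case_sum (\<lambda>g. [Inl g]) (separating_word G a)) u)"

lemma separating_word_lists:
  assumes "group G" "a \<in> carrier G"
  shows "separating_word G a l \<in> lists (Inl ` carrier G \<union> Inr ` carrier integer_group)"
proof -
  interpret group G by fact
  show ?thesis using assms(2) by (auto simp: separating_word_def Let_def split: prod.split)
qed

text \<open>Reading a reduced mixed word from right to left, each new letter leaves a normal form whose
  beginning is under control: a constant stays, and of \<open>t\<^sup>k a t\<^sup>k\<close> at least \<open>t\<^sup>k a\<close> stays, as only the
  last power of \<open>t\<close> can merge with what follows. It never cancels: it meets the end of the word, a
  nontrivial constant, or a power of \<open>t\<close> whose exponent is not \<open>- k\<close>, because that exponent would
  come from the inverse of the same basis element. Since only the beginning matters, the remainder
  \<open>r\<close> is left unspecified.\<close>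

lemma separating_image_normal_form:
  assumes G: "group G" and a: "a \<in> carrier G" "a \<noteq> \<one>\<^bsub>G\<^esub>"
    and u: "u \<in> mixed_words G X" "reduced_mixed_word G u" "u \<noteq> []"
  shows "\<exists>r. foldr (group_pair.push G integer_group) (separating_image G a u) [] =
    (case hd u of Inl g \<Rightarrow> [Inl g] | Inr l \<Rightarrow> butlast (separating_word G a l)) @ r"
proof -
  interpret group_pair G integer_group using G by (simp add: group_pair_def)
  have inv_a: "inv\<^bsub>G\<^esub> a \<noteq> \<one>\<^bsub>G\<^esub>" using a by simp
  show ?thesis using u
  proof (induction u)
    case (Cons l u)
    let ?r = "foldr push (separating_image G a u) []"
    have red: "u \<in> mixed_words G X" "reduced_mixed_word G u" "l \<noteq> Inl \<one>\<^bsub>G\<^esub>"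
      and adj: "u \<noteq> [] \<Longrightarrow> irreducible_pair l (hd u)"
      using Cons.prems by (cases u; auto simp: mixed_words_def reduced_mixed_word_def)+
    have nil: "?r = []" if "u = []" using that by (simp add: separating_image_def)
    note IH = Cons.IH[OF red(1,2)]
    show ?case
    proof (cases l)
      case (Inl g)
      have "?r = [] \<or> \<not> isl (hd ?r)"
      proof (cases u)
        case (Cons m u')
        with adj Inl obtain j c where m: "m = Inr (j, c)" by (cases m) auto
        with IH Cons show ?thesis by (auto simp: separating_word_def Let_def)
      next
        case Nil
        then show ?thesis using nil by blast
      qed
      then have "push (Inl g) ?r = Inl g # ?r"
        using red(3) Inl by (cases ?r) (auto simp: push_def)
      then show ?thesis using Inl by (simp add: separating_image_def)
    next
      case (Inr p)
      obtain i b where p: "p = (i, b)" by (cases p)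
      define k where "k = (if b then int i + 1 else - (int i + 1))"
      define c where "c = (if b then a else inv\<^bsub>G\<^esub> a)"
      have k0: "k \<noteq> 0" by (auto simp: k_def)
      have c1: "c \<noteq> \<one>\<^bsub>G\<^esub>" using a inv_a by (auto simp: c_def)
      have sw: "separating_word G a p = [Inr k, Inl c, Inr k]"
        by (simp add: separating_word_def Let_def p k_def c_def)
      have "\<exists>m r'. push (Inr k) ?r = Inr m # r'"
      proof (cases u)
        case Nil
        then show ?thesis using nil k0 by (simp add: push_def)
      next
        case (Cons x u')
        show ?thesis
        proof (cases x)
          case (Inl g)
          then obtain r' where "?r = Inl g # r'" using IH Cons by auto
          then show ?thesis using k0 by (simp add: push_def)
        next
          case (Inr q)
          obtain j d where q: "q = (j, d)" by (cases q)
          define k' where "k' = (if d then int j + 1 else - (int j + 1))"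
          obtain r' where r': "?r = Inr k' # r'"
            using IH Cons Inr q by (auto simp: separating_word_def Let_def k'_def)
          have "i = j \<Longrightarrow> b = d" using adj Cons Inr q p \<open>l = Inr p\<close> by simp
          then have "k + k' \<noteq> 0" by (auto simp: k_def k'_def split: if_splits)
          then show ?thesis using r' k0 by (simp add: push_def)
        qed
      qed
      then obtain m r' where mr: "push (Inr k) ?r = Inr m # r'" by blast
      have "push (Inr k) (push (Inl c) (push (Inr k) ?r)) = Inr k # Inl c # Inr m # r'"
        unfolding mr using k0 c1 by (simp add: push_def)
      then show ?thesis using Inr sw by (simp add: separating_image_def)
    qed
  qed simp
qed

section \<open>Expressing mixed words by terms\<close>

text \<open>The variables below \<open>m\<close> name the constants of the word, in the order given by \<open>ix\<close>; those from \<open>m\<close>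
  on stand for the basis of the free group.\<close>

definition mixed_term :: "('a \<Rightarrow> nat) \<Rightarrow> nat \<Rightarrow> ('a + nat \<times> bool) list \<Rightarrow> gterm" where
  "mixed_term ix m u = foldr (\<lambda>l. Times (case l of
      Inl g \<Rightarrow> Var (ix g)
    | Inr (i, b) \<Rightarrow> if b then Var (m + i) else Inv (Var (m + i)))) u Unit"

lemma term_val_mixed_term:
  "term_val K e (mixed_term ix m u) =
     word_eval K (case_sum (\<lambda>g. e (ix g)) (literal K (\<lambda>i. e (m + i)))) u"
  by (induction u) (auto simp: mixed_term_def word_eval_def literal_def split: sum.split)

lemma term_vars_mixed_term:
  assumes "u \<in> mixed_words G {..<n}" "\<And>g. Inl g \<in> set u \<Longrightarrow> ix g < m"
  shows "term_vars (mixed_term ix m u) \<subseteq> {..<m + n}"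
  using assms
proof (induction u)
  case (Cons l u)
  then have "u \<in> mixed_words G {..<n}" by (auto simp: mixed_words_def)
  then have "term_vars (mixed_term ix m u) \<subseteq> {..<m + n}" using Cons by simp
  then show ?case
    using Cons.prems by (cases l) (auto simp: mixed_term_def mixed_words_def trans_less_add1 split: if_splits)
qed (simp add: mixed_term_def)

lemma free_vars_Alls: "free_vars (Alls xs \<phi>) = free_vars \<phi> - set xs"
  by (induction xs) (auto simp: Alls_def)

text \<open>The listed variables may repeat, which is why the block is described by environments that
  agree with \<open>e\<close> off the list rather than by tuples of values.\<close>

lemma holds_Alls:
  "holds K e (Alls xs \<phi>) \<longleftrightarrow>
     (\<forall>e'. (\<forall>i. i \<notin> set xs \<longrightarrow> e' i = e i) \<longrightarrow> (\<forall>i\<in>set xs. e' i \<in> carrier K) \<longrightarrow> holds K e' \<phi>)"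
proof (induction xs arbitrary: e)
  case Nil
  have "e' = e" if "\<forall>i. e' i = e i" for e' using that by auto
  then show ?case by (auto simp: Alls_def)
next
  case (Cons x xs)
  have "holds K e (Alls (x # xs) \<phi>) \<longleftrightarrow> (\<forall>a\<in>carrier K. holds K (e(x := a)) (Alls xs \<phi>))"
    by (simp add: Alls_def)
  also have "\<dots> \<longleftrightarrow> (\<forall>e'. (\<forall>i. i \<notin> set (x # xs) \<longrightarrow> e' i = e i) \<longrightarrow>
      (\<forall>i\<in>set (x # xs). e' i \<in> carrier K) \<longrightarrow> holds K e' \<phi>)"
  proof (intro iffI allI impI ballI)
    fix e' assume H: "\<forall>a\<in>carrier K. holds K (e(x := a)) (Alls xs \<phi>)"
      and e': "\<forall>i. i \<notin> set (x # xs) \<longrightarrow> e' i = e i" "\<forall>i\<in>set (x # xs). e' i \<in> carrier K"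
    then have "holds K (e(x := e' x)) (Alls xs \<phi>)" by simp
    then show "holds K e' \<phi>" using e' unfolding Cons.IH by auto
  next
    fix a assume H: "\<forall>e'. (\<forall>i. i \<notin> set (x # xs) \<longrightarrow> e' i = e i) \<longrightarrow>
      (\<forall>i\<in>set (x # xs). e' i \<in> carrier K) \<longrightarrow> holds K e' \<phi>" and a: "a \<in> carrier K"
    show "holds K (e(x := a)) (Alls xs \<phi>)"
      unfolding Cons.IH
    proof (intro allI impI)
      fix e' assume e': "\<forall>i. i \<notin> set xs \<longrightarrow> e' i = (e(x := a)) i" "\<forall>i\<in>set xs. e' i \<in> carrier K"
      have "e' x \<in> carrier K" using e' a by (cases "x \<in> set xs") auto
      then show "holds K e' \<phi>" using H e' by auto
    qed
  qed
  finally show ?case .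
qed

text \<open>Vanishing of a mixed word under all substitutions is a universal property of its constants, and
  a universal formula is an \<open>\<exists>\<forall>\<exists>\<close>-formula with empty existential blocks.\<close>

lemma mixed_identity_transfers:
  fixes G :: "('a, 'm) monoid_scheme" and n :: nat
  assumes emb: "EAE_embeds_free_product_Z G" and u: "u \<in> mixed_words G {..<n}"
    and id: "\<And>\<xi>. \<xi> \<in> {..<n} \<rightarrow> carrier G \<Longrightarrow> word_eval G (case_sum (\<lambda>g. g) (literal G \<xi>)) u = \<one>\<^bsub>G\<^esub>"
    and \<xi>: "\<xi> \<in> {..<n} \<rightarrow> carrier (free_product G integer_group)"
  shows "word_eval (free_product G integer_group)
      (case_sum (free_product_inl G integer_group) (literal (free_product G integer_group) \<xi>)) u =
    \<one>\<^bsub>free_product G integer_group\<^esub>"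
proof -
  let ?P = "free_product G integer_group" and ?\<iota> = "free_product_inl G integer_group"
  define \<gamma> where "\<gamma> = map projl (filter isl u)"
  define m where "m = length \<gamma>"
  define ix where "ix g = (SOME i. i < m \<and> \<gamma> ! i = g)" for g
  define xs where "xs = [m..<m + n]"
  have set\<gamma>: "g \<in> set \<gamma> \<longleftrightarrow> Inl g \<in> set u" for g
  proof
    assume "Inl g \<in> set u"
    then have "projl (Inl g :: 'a + nat \<times> bool) \<in> set \<gamma>"
      unfolding \<gamma>_def set_map set_filter by (intro imageI) simp
    then show "g \<in> set \<gamma>" by simp
  next
    assume "g \<in> set \<gamma>"
    then show "Inl g \<in> set u" by (auto simp: \<gamma>_def)
  qed
  have ix: "ix g < m \<and> \<gamma> ! ix g = g" if "Inl g \<in> set u" for g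
  proof -
    have "\<exists>i. i < m \<and> \<gamma> ! i = g"
      using that set\<gamma>[of g] unfolding m_def by (metis in_set_conv_nth)
    then show ?thesis unfolding ix_def by (rule someI_ex)
  qed
  have \<gamma>: "set \<gamma> \<subseteq> carrier G"
  proof
    fix g assume "g \<in> set \<gamma>"
    then have "Inl g \<in> set u" using set\<gamma> by blast
    then show "g \<in> carrier G" using u unfolding mixed_words_def by blast
  qed
  define \<Sigma> where "\<Sigma> = Exs [] (Alls xs (Exs [] (Eq (mixed_term ix m u) Unit)))"
  \<comment> \<open>The value of the word depends only on the values that occur in it.\<close>
  have agree: "word_eval K (case_sum (\<lambda>g. e (ix g)) (literal K (\<lambda>i. e (m + i)))) u =
      word_eval K (case_sum p (literal K \<zeta>)) u"
    if "\<And>g. Inl g \<in> set u \<Longrightarrow> e (ix g) = p g" "\<And>i. i < n \<Longrightarrow> e (m + i) = \<zeta> i"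
    for K :: "('k, 'l) monoid_scheme" and e p \<zeta>
    using that u
  proof (induction u)
    case (Cons l u)
    then have "u \<in> mixed_words G {..<n}" by (auto simp: mixed_words_def)
    then show ?case
      using Cons by (cases l) (auto simp: word_eval_def mixed_words_def literal_def)
  qed (simp add: word_eval_def)
  have "\<Sigma> \<in> Th_EAE G \<gamma>"
    unfolding Th_EAE_def
  proof (intro CollectI conjI)
    show "\<exists>xs ys ts \<phi>. \<Sigma> = Exs xs (Alls ys (Exs ts \<phi>)) \<and> quantifier_free \<phi>"
      unfolding \<Sigma>_def
      by (rule exI[of _ "[]"], rule exI[of _ xs], rule exI[of _ "[]"],
          rule exI[of _ "Eq (mixed_term ix m u) Unit"]) simp
    show "free_vars \<Sigma> \<subseteq> {..<length \<gamma>}"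
      using term_vars_mixed_term[OF u, of ix m] ix
      by (auto simp: \<Sigma>_def Exs_def free_vars_Alls xs_def m_def)
    show "holds G (tuple_env G \<gamma>) \<Sigma>"
    proof (simp add: \<Sigma>_def Exs_def holds_Alls term_val_mixed_term, intro allI impI)
      fix e assume e: "\<forall>i. i \<notin> set xs \<longrightarrow> e i = tuple_env G \<gamma> i" "\<forall>i\<in>set xs. e i \<in> carrier G"
      have "(\<lambda>i. e (m + i)) \<in> {..<n} \<rightarrow> carrier G" using e(2) by (auto simp: xs_def)
      moreover have "e (ix g) = g" if "Inl g \<in> set u" for g
        using ix[OF that] e(1) by (simp add: xs_def tuple_env_def m_def)
      ultimately show "word_eval G (case_sum (\<lambda>g. e (ix g)) (literal G (\<lambda>i. e (m + i)))) u = \<one>\<^bsub>G\<^esub>"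
        using agree[of e "\<lambda>g. g" "\<lambda>i. e (m + i)" G] id by simp
    qed
  qed
  then have "\<Sigma> \<in> Th_EAE ?P (map ?\<iota> \<gamma>)"
    using emb \<gamma> unfolding EAE_embeds_free_product_Z_def by blast
  then have \<Sigma>: "holds ?P (tuple_env ?P (map ?\<iota> \<gamma>)) \<Sigma>" by (simp add: Th_EAE_def)
  define e where "e i = (if i \<in> set xs then \<xi> (i - m) else tuple_env ?P (map ?\<iota> \<gamma>) i)" for i
  have "word_eval ?P (case_sum (\<lambda>g. e (ix g)) (literal ?P (\<lambda>i. e (m + i)))) u = \<one>\<^bsub>?P\<^esub>"
  proof -
    have "\<forall>i\<in>set xs. e i \<in> carrier ?P" using \<xi> by (auto simp: e_def xs_def Pi_iff)
    moreover have "\<forall>i. i \<notin> set xs \<longrightarrow> e i = tuple_env ?P (map ?\<iota> \<gamma>) i" by (simp add: e_def)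
    ultimately show ?thesis
      using \<Sigma> by (simp add: \<Sigma>_def Exs_def holds_Alls term_val_mixed_term)
  qed
  moreover have "e (ix g) = ?\<iota> g" if "Inl g \<in> set u" for g
    using ix[OF that] by (simp add: e_def xs_def tuple_env_def m_def)
  moreover have "e (m + i) = \<xi> i" if "i < n" for i using that by (simp add: e_def xs_def)
  ultimately show ?thesis using agree[of e ?\<iota> \<xi> ?P] by simp
qed

section \<open>Mixed identity freeness\<close>

text \<open>In \<open>G * \<int>\<close> the separating words turn a reduced word that represents a mixed identity into a
  word for \<open>1\<close>; by the normal form above, this leaves only the empty mixed word.\<close>

theorem EAE_embeds_imp_mixed_identity_free:
  assumes G: "group G" and nontriv: "carrier G \<noteq> {\<one>\<^bsub>G\<^esub>}" and emb: "EAE_embeds_free_product_Z G"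
  shows "mixed_identity_free G"
  unfolding mixed_identity_free_def
proof (intro allI impI)
  fix n w assume "mixed_identity G n w"
  then have w: "w \<in> carrier (free_product G (free_group {..<n}))"
    and w1: "\<And>\<xi>. \<xi> \<in> {..<n} \<rightarrow> carrier G \<Longrightarrow> word_subst G \<xi> w = \<one>\<^bsub>G\<^esub>"
    by (auto simp: mixed_identity_def)
  interpret group_pair G integer_group using G by (simp add: group_pair_def)
  let ?P = "free_product G integer_group"
  interpret P: group ?P by (rule free_product_group[OF G group_integer_group])
  obtain a where a: "a \<in> carrier G" "a \<noteq> \<one>\<^bsub>G\<^esub>" using nontriv G.one_closed by blast
  obtain u where u: "u \<in> mixed_words G {..<n}" "reduced_mixed_word G u" "w = mixed_class G {..<n} u"
    using reduced_mixed_word_exists[OF G w] by blast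
  define \<xi> where "\<xi> i = cls (separating_word G a (i, True))" for i
  have sw: "separating_word G a l \<in> lists letters" for l
    using separating_word_lists[OF G a(1)] .
  have \<xi>: "\<xi> \<in> {..<n} \<rightarrow> carrier ?P" using cls_closed[OF sw] by (auto simp: \<xi>_def)
  \<comment> \<open>Inverting a basis element must agree with the word chosen for its inverse letter.\<close>
  have "literal ?P \<xi> (i, b) = cls (separating_word G a (i, b))" for i b
  proof (cases b)
    case False
    define k where "k = int i + 1"
    have c1: "cong ([Inr (- k), Inl (inv\<^bsub>G\<^esub> a)] @ [Inr (- k), Inr k] @ [Inl a, Inr k])
        ([Inr (- k), Inl (inv\<^bsub>G\<^esub> a)] @ [Inl a, Inr k])"
      by (rule cong_cancel) (use a in auto)
    have c2: "cong ([Inr (- k)] @ [Inl (inv\<^bsub>G\<^esub> a), Inl a] @ [Inr k]) ([Inr (- k)] @ [Inr k])"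
      by (rule cong_cancel) (use a in auto)
    have c3: "cong ([] @ [Inr (- k), Inr k] @ []) ([] @ [])"
      by (rule cong_cancel) auto
    have "cls (separating_word G a (i, False) @ separating_word G a (i, True)) = cls []"
      using cls_eqI[OF c1] cls_eqI[OF c2] cls_eqI[OF c3]
      by (simp add: separating_word_def Let_def flip: k_def)
    then have "cls (separating_word G a (i, False)) \<otimes>\<^bsub>?P\<^esub> \<xi> i = \<one>\<^bsub>?P\<^esub>"
      unfolding \<xi>_def cls_mult[OF sw sw] cls_Nil .
    then have "inv\<^bsub>?P\<^esub> (\<xi> i) = cls (separating_word G a (i, False))"
      using P.inv_equality cls_closed[OF sw] by (simp add: \<xi>_def)
    then show ?thesis using False by (simp add: literal_def)
  qed (simp add: literal_def \<xi>_def)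
  then have "case_sum (free_product_inl G integer_group) (literal ?P \<xi>) =
      (\<lambda>l. cls (case_sum (\<lambda>g. [Inl g]) (separating_word G a) l))"
    by (auto simp: fun_eq_iff free_product_inl_def split: sum.split)
  moreover have \<sigma>: "case_sum (\<lambda>g. [Inl g]) (separating_word G a) l \<in> lists letters" if "l \<in> set u" for l
  proof (cases l)
    case (Inl g)
    with that have "g \<in> carrier G" using u(1) unfolding mixed_words_def by blast
    with Inl show ?thesis by simp
  next
    case (Inr p)
    then show ?thesis using sw[of p] by simp
  qed
  moreover have "word_eval ?P (case_sum (free_product_inl G integer_group) (literal ?P \<xi>)) u = \<one>\<^bsub>?P\<^esub>"
    using mixed_identity_transfers[OF emb u(1) _ \<xi>] w1 word_subst_mixed_class[OF G u(1)] u(3) by simp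
  ultimately have one: "cls (separating_image G a u) = \<one>\<^bsub>?P\<^esub>"
    using word_eval_cls[of u] by (simp add: separating_image_def)
  have lists: "separating_image G a u \<in> lists letters"
    using \<sigma> unfolding separating_image_def in_lists_conv_set set_concat set_map by blast
  have "u = []"
  proof (rule ccontr)
    assume "u \<noteq> []"
    from separating_image_normal_form[OF G a u(1,2) this]
    have "foldr push (separating_image G a u) [] \<noteq> []"
      by (auto simp: separating_word_def Let_def split: sum.splits)
    then show False using cls_neq_one[OF lists] one by simp
  qed
  then show "w = \<one>\<^bsub>free_product G (free_group {..<n})\<^esub>"
    using u(3) by (simp add: mixed_class_def free_product_def presented_monoid_def)
qed

section \<open>Two-transitive actions\<close>

text \<open>An element that swaps two points \<open>x\<close> and \<open>y\<close> has a square that commutes with the abelian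
  stabilizer of \<open>x\<close>. This stabilizer moves \<open>y\<close> to every point other than \<open>x\<close>, so the square acts
  trivially. By simplicity the action is faithful, hence the square is \<open>1\<close>, and by torsion-freeness
  so is the element itself, which however moves \<open>x\<close>.\<close>

theorem no_two_transitive_action:
  assumes simple: "is_simple G" and tf: "torsion_free G"
    and ab: "\<And>S. subgroup S G \<Longrightarrow> S \<noteq> carrier G \<Longrightarrow> comm_group (G\<lparr>carrier := S\<rparr>)"
  shows "\<not> two_transitive_action G X \<phi>"
proof
  assume act: "two_transitive_action G X \<phi>"
  then interpret group_action G X \<phi> by (simp add: two_transitive_action_def)
  interpret \<phi>: group_hom G "BijGroup X" \<phi> by (rule group_hom)
  interpret group G by (rule \<phi>.G.is_group)
  have two: "\<exists>g\<in>carrier G. \<phi> g p = p' \<and> \<phi> g q = q'"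
    if "p \<in> X" "q \<in> X" "p' \<in> X" "q' \<in> X" "p \<noteq> q" "p' \<noteq> q'" for p q p' q'
    using act that unfolding two_transitive_action_def by blast
  obtain x y where xy: "x \<in> X" "y \<in> X" "x \<noteq> y"
    using act by (auto simp: two_transitive_action_def)
  obtain g where g: "g \<in> carrier G" "\<phi> g x = y" "\<phi> g y = x" using two[of x y y x] xy by auto
  let ?S = "stabilizer G \<phi> x"
  have "g \<notin> ?S" using g xy by (simp add: stabilizer_def)
  then have "comm_group (G\<lparr>carrier := ?S\<rparr>)" using ab[OF stabilizer_subgroup[OF xy(1)]] g(1) by blast
  then have comm: "h \<otimes>\<^bsub>G\<^esub> k = k \<otimes>\<^bsub>G\<^esub> h" if "h \<in> ?S" "k \<in> ?S" for h k
    using comm_groupE(4)[of "G\<lparr>carrier := ?S\<rparr>"] that by simp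
  define s where "s = g \<otimes>\<^bsub>G\<^esub> g"
  have s: "s \<in> carrier G" using g by (simp add: s_def)
  have fix_xy: "\<phi> s x = x" "\<phi> s y = y" using composition_rule g xy by (simp_all add: s_def)
  have fixed: "\<phi> s z = z" if z: "z \<in> X" for z
  proof (cases "z = x")
    case False
    then obtain h where h: "h \<in> carrier G" "\<phi> h x = x" "\<phi> h y = z" using two[of x y x z] xy z by auto
    have "s \<otimes>\<^bsub>G\<^esub> h = h \<otimes>\<^bsub>G\<^esub> s" using comm s h fix_xy by (simp add: stabilizer_def)
    then have "\<phi> s (\<phi> h y) = \<phi> h (\<phi> s y)" using composition_rule[OF xy(2)] s h(1) by metis
    then show ?thesis using h fix_xy by simp
  qed (simp add: fix_xy)
  have ker: "kernel G (BijGroup X) \<phi> = {k \<in> carrier G. \<forall>z\<in>X. \<phi> k z = z}"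
  proof -
    have "\<phi> k = \<one>\<^bsub>BijGroup X\<^esub> \<longleftrightarrow> (\<forall>z\<in>X. \<phi> k z = z)" if "k \<in> carrier G" for k
      using bij_prop0[OF that] by (auto simp: BijGroup_def Bij_def extensional_def restrict_def fun_eq_iff)
    then show ?thesis by (auto simp: kernel_def)
  qed
  have "kernel G (BijGroup X) \<phi> \<noteq> carrier G" 
  proof
    assume "kernel G (BijGroup X) \<phi> = carrier G"
    then have "\<phi> g x = x" using g(1) xy(1) unfolding ker by blast
    then show False using g xy by simp
  qed
  moreover have "kernel G (BijGroup X) \<phi> \<lhd> G" by (rule \<phi>.normal_kernel)
  ultimately have "kernel G (BijGroup X) \<phi> = {\<one>\<^bsub>G\<^esub>}" using simple unfolding is_simple_def by blast
  then have "s = \<one>\<^bsub>G\<^esub>" using s fixed unfolding ker by blast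
  then have "g [^]\<^bsub>G\<^esub> (2::nat) = \<one>\<^bsub>G\<^esub>" using g(1) by (simp add: s_def numeral_2_eq_2)
  then have "g = \<one>\<^bsub>G\<^esub>" using tf g(1) unfolding torsion_free_def by (metis zero_less_numeral)
  then show False using s g xy fix_xy \<open>s = \<one>\<^bsub>G\<^esub>\<close> by simp
qed

lemma tarski_monster_proper_subgroups_abelian:
  assumes "torsion_free_tarski_monster G" "subgroup S G" "S \<noteq> carrier G"
  shows "comm_group (G\<lparr>carrier := S\<rparr>)"
proof -
  interpret group G using assms(1) by (simp add: torsion_free_tarski_monster_def)
  interpret S: group "G\<lparr>carrier := S\<rparr>" using assms(2) by (rule subgroup.subgroup_is_group[OF _ is_group])
  show ?thesis
  proof (cases "S = {\<one>\<^bsub>G\<^esub>}")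
    case True
    show ?thesis by (rule S.group_comm_groupI) (simp add: True)
  next
    case False
    then have "cyclic_group (G\<lparr>carrier := S\<rparr>)"
      using assms unfolding torsion_free_tarski_monster_def by blast
    then show ?thesis by (rule S.cyclic_imp_abelian_group)
  qed
qed

section \<open>The limit group\<close>

theorem corollary1p6:
  fixes \<Gamma> :: "nat \<Rightarrow> 'a monoid"
    and f :: "nat \<Rightarrow> 'a \<Rightarrow> 'a"
    and \<Gamma>lim :: "(nat \<times> 'a) set monoid"
    and \<pi> :: "nat \<Rightarrow> 'a \<Rightarrow> 'a"
    and \<pi>lim :: "'a \<Rightarrow> (nat \<times> 'a) set"
  assumes hyp: "\<And>k. hyperbolic_group (\<Gamma> k)"
    and tf: "\<And>k. torsion_free (\<Gamma> k)"
    and nonelem: "\<And>k. \<not> elementary (\<Gamma> k)"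
    and epi: "\<And>k. f k \<in> epi (\<Gamma> k) (\<Gamma> (Suc k))"
    and limit: "\<Gamma>lim = direct_limit \<Gamma> f"
    and proj: "\<And>k. \<pi> k = transition f 0 k"
    and proj_inf: "\<pi>lim = dlim_map \<Gamma> f 0"
    and i: "lacunary_hyperbolic \<Gamma>lim" "is_simple \<Gamma>lim" "torsion_free_tarski_monster \<Gamma>lim"
    and ii: "\<And>N. group_norm \<Gamma>lim N \<Longrightarrow> conj_invariant_norm \<Gamma>lim N \<Longrightarrow> \<not> trivial_norm \<Gamma>lim N \<Longrightarrow>
                   stably_bounded \<Gamma>lim N"
    and iii: "\<And>\<gamma>. set \<gamma> \<subseteq> carrier (\<Gamma> 0) \<Longrightarrow>
                   set_lim (\<lambda>k. Th_AE (\<Gamma> k) (map (\<pi> k) \<gamma>)) (Th_AE \<Gamma>lim (map \<pi>lim \<gamma>))"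
    and iv: "EAE_embeds_free_product_Z \<Gamma>lim"
  shows "mixed_identity_free \<Gamma>lim \<and>
         \<not> (\<exists>(X :: 'x set) \<phi>. two_transitive_action \<Gamma>lim X \<phi>)"
proof
  have G: "group \<Gamma>lim" and tfl: "torsion_free \<Gamma>lim"
    using i(3) by (auto simp: torsion_free_tarski_monster_def)
  have "carrier \<Gamma>lim \<noteq> {\<one>\<^bsub>\<Gamma>lim\<^esub>}" using i(2) by (simp add: is_simple_def)
  then show "mixed_identity_free \<Gamma>lim"
    by (rule EAE_embeds_imp_mixed_identity_free[OF G _ iv])
  show "\<not> (\<exists>(X :: 'x set) \<phi>. two_transitive_action \<Gamma>lim X \<phi>)"
    using no_two_transitive_action[OF i(2) tfl] tarski_monster_proper_subgroups_abelian[OF i(3)]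
    by blast
qed

end
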